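(* Let $K$ be a field, $S=K[x_1,\ldots,x_n]$, and let $I\subset S$ be a monomial ideal with minimal system of monomial generators $f_1,\ldots,f_m$. Let $<_x$ be a monomial order on $S$, let $<'$ be a monomial order on $K[y_1,\ldots,y_m]$ induced by $y_1<'\cdots<'y_m$, and let $<$ be the monomial order on $T=K[x_1,\ldots,x_n,y_1,\ldots,y_m]$ given by: $uw<u'w'$ (with $u,u'$ monomials in the $x_i$ and $w,w'$ monomials in the $y_j$) if $w<'w'$, or $w=w'$ and $u<_xu'$. Let $J\subset T$ be the defining ideal of the Rees ring $\mathcal R(I)$, i.e. the kernel of the $K$-algebra homomorphism $T\to \mathcal R(I)=\bigoplus_{k\ge0}I^kt^k\subset S[t]$ with $x_i\mapsto x_i$, $y_j\mapsto f_jt$. If $\operatorname{in}_<(J)$ is generated by quadratic monomials, then all powers $I^k$ ($k\ge1$) of $I$ have linear quotients with respect to their minimal generating sets, and hence they are componentwise linear.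
   Context: "Quadratic" means of total degree $2$ in the variables $x_1,\ldots,x_n,y_1,\ldots,y_m$ (each variable counted with degree $1$). A monomial ideal $L\subset S$ has linear quotients with respect to its minimal generating set if its minimal monomial generators can be ordered $g_1,\ldots,g_r$ so that for each $j$ the colon ideal $(g_1,\ldots,g_{j-1}):g_j$ is generated by linear forms (the zero ideal is allowed). For a graded $S$-module $M$, $M_{\langle k\rangle}$ is the submodule generated by all elements of degree $k$; $M$ is componentwise linear if $M_{\langle k\rangle}$ has a linear resolution for every $k$. *)

theory Defs
  imports Complex_Main "HOL-Library.Poly_Mapping" "HOL-Computational_Algebra.Polynomial"
begin

text \<open>
  A monomial in variables indexed by \<open>'v\<close> is represented by its exponent vector, so the
  product of monomials is written \<open>+\<close> and the monomial \<open>1\<close> is \<open>0\<close>.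
  For finite \<open>'x\<close>, the type \<open>('x, 'k) mpoly\<close> is the ring \<open>S = K[x\<^sub>1,\<dots>,x\<^sub>n]\<close>
  with \<open>n = CARD('x)\<close>.
\<close>

type_synonym 'v mon = "'v \<Rightarrow>\<^sub>0 nat"
type_synonym ('v, 'k) mpoly = "('v \<Rightarrow>\<^sub>0 nat) \<Rightarrow>\<^sub>0 'k"

definition deg :: "'v mon \<Rightarrow> nat" where
  "deg u = (\<Sum>v\<in>Poly_Mapping.keys u. Poly_Mapping.lookup u v)"

definition pmon :: "'v mon \<Rightarrow> ('v, 'k::field) mpoly" where
  "pmon u = Poly_Mapping.single u 1"

definition homogeneous :: "int \<Rightarrow> ('v, 'k::field) mpoly \<Rightarrow> bool" where
  "homogeneous d p \<longleftrightarrow> (\<forall>u\<in>Poly_Mapping.keys p. int (deg u) = d)"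

definition mons_in :: "'v set \<Rightarrow> 'v mon set" where
  "mons_in V = {u. Poly_Mapping.keys u \<subseteq> V}"

text \<open>The subring of polynomials that involve only variables from \<open>V\<close>.\<close>

definition polys_in :: "'v set \<Rightarrow> ('v, 'k::field) mpoly set" where
  "polys_in V = {p. Poly_Mapping.keys p \<subseteq> mons_in V}"

text \<open>The ideal generated by \<open>B\<close>: in the whole ring type, and in a subring \<open>R\<close> containing \<open>B\<close>.\<close>

abbreviation ideal_span :: "'a::comm_ring_1 set \<Rightarrow> 'a set" where
  "ideal_span \<equiv> module.span (*)"

definition ideal_span_in :: "'a::comm_ring_1 set \<Rightarrow> 'a set \<Rightarrow> 'a set" where
  "ideal_span_in R B = {\<Sum>b\<in>F. q b * b | F q. finite F \<and> F \<subseteq> B \<and> q ` F \<subseteq> R}"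

definition ideal_prod :: "'a::comm_ring_1 set \<Rightarrow> 'a set \<Rightarrow> 'a set" where
  "ideal_prod I J = ideal_span {a * b | a b. a \<in> I \<and> b \<in> J}"

primrec ideal_power :: "'a::comm_ring_1 set \<Rightarrow> nat \<Rightarrow> 'a set" where
  "ideal_power I 0 = UNIV"
| "ideal_power I (Suc k) = ideal_prod I (ideal_power I k)"

definition colon :: "'a::comm_ring_1 set \<Rightarrow> 'a \<Rightarrow> 'a set" where
  "colon I g = {p. p * g \<in> I}"

text \<open>Any ideal possessing such a set \<open>G\<close> is a monomial ideal, and \<open>G\<close> is then unique.\<close>

definition minimal_monomial_generators ::
    "'v mon set \<Rightarrow> ('v, 'k::field) mpoly set \<Rightarrow> bool" where
  "minimal_monomial_generators G I \<longleftrightarrow>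
     ideal_span (pmon ` G) = I \<and> (\<forall>G'. G' \<subset> G \<longrightarrow> ideal_span (pmon ` G') \<noteq> I)"

definition linear_quotients :: "('v, 'k::field) mpoly set \<Rightarrow> bool" where
  "linear_quotients L \<longleftrightarrow>
     (\<exists>gs :: 'v mon list. distinct gs \<and> minimal_monomial_generators (set gs) L \<and>
        (\<forall>j<length gs. \<exists>A :: ('v, 'k) mpoly set. (\<forall>l\<in>A. homogeneous 1 l) \<and>
           colon (ideal_span (pmon ` set (take j gs))) (pmon (gs ! j)) = ideal_span A))"


section \<open>Monomial orders and initial ideals\<close>

text \<open>Only the restriction of the (strict) relation \<open>lt\<close> to monomials in the variables \<open>V\<close> matters.\<close>

definition monomial_order :: "'v set \<Rightarrow> ('v mon \<Rightarrow> 'v mon \<Rightarrow> bool) \<Rightarrow> bool" where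
  "monomial_order V lt \<longleftrightarrow>
     (\<forall>u\<in>mons_in V. \<not> lt u u) \<and>
     (\<forall>u\<in>mons_in V. \<forall>v\<in>mons_in V. \<forall>w\<in>mons_in V. lt u v \<longrightarrow> lt v w \<longrightarrow> lt u w) \<and>
     (\<forall>u\<in>mons_in V. \<forall>v\<in>mons_in V. u \<noteq> v \<longrightarrow> lt u v \<or> lt v u) \<and>
     (\<forall>u\<in>mons_in V. u \<noteq> 0 \<longrightarrow> lt 0 u) \<and>
     (\<forall>u\<in>mons_in V. \<forall>v\<in>mons_in V. \<forall>w\<in>mons_in V. lt u v \<longrightarrow> lt (u + w) (v + w))"

text \<open>Exponents of the initial monomials of the nonzero elements of \<open>J\<close>.\<close>

definition initial_mons ::
    "('v mon \<Rightarrow> 'v mon \<Rightarrow> bool) \<Rightarrow> ('v, 'k::field) mpoly set \<Rightarrow> 'v mon set" where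
  "initial_mons lt J = {u. \<exists>p\<in>J. u \<in> Poly_Mapping.keys p \<and>
                            (\<forall>v\<in>Poly_Mapping.keys p. v \<noteq> u \<longrightarrow> lt v u)}"

definition initial_ideal ::
    "'v set \<Rightarrow> ('v mon \<Rightarrow> 'v mon \<Rightarrow> bool) \<Rightarrow> ('v, 'k::field) mpoly set \<Rightarrow> ('v, 'k) mpoly set" where
  "initial_ideal V lt J = ideal_span_in (polys_in V) (pmon ` initial_mons lt J)"

definition generated_by_quadratic_monomials ::
    "'v set \<Rightarrow> ('v, 'k::field) mpoly set \<Rightarrow> bool" where
  "generated_by_quadratic_monomials V L \<longleftrightarrow>
     (\<exists>Q \<subseteq> mons_in V. (\<forall>u\<in>Q. deg u = 2) \<and> L = ideal_span_in (polys_in V) (pmon ` Q))"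


section \<open>The defining ideal of the Rees ring\<close>

text \<open>
  The ring \<open>T = K[x\<^sub>1,\<dots>,x\<^sub>n,y\<^sub>1,\<dots>,y\<^sub>m]\<close> is \<open>polys_in (T_vars m)\<close>: the variable \<open>x\<^sub>i\<close> is \<open>Inl i\<close>,
  and the \<open>y\<close>-variables are \<open>Inr 0, \<dots>, Inr (m - 1)\<close>. Cutting them out of a ring with infinitely
  many variables admits \<open>m = 0\<close>, i.e. the zero ideal.
\<close>

definition T_vars :: "nat \<Rightarrow> ('x + nat) set" where
  "T_vars m = range Inl \<union> Inr ` {..<m}"

definition x_part :: "('x + nat) mon \<Rightarrow> 'x mon" where
  "x_part u = Poly_Mapping.map_key Inl u"

definition y_part :: "('x + nat) mon \<Rightarrow> nat mon" where
  "y_part u = Poly_Mapping.map_key Inr u"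

definition T_order ::
    "('x mon \<Rightarrow> 'x mon \<Rightarrow> bool) \<Rightarrow> (nat mon \<Rightarrow> nat mon \<Rightarrow> bool) \<Rightarrow>
     ('x + nat) mon \<Rightarrow> ('x + nat) mon \<Rightarrow> bool" where
  "T_order ltx lty u v \<longleftrightarrow>
     lty (y_part u) (y_part v) \<or> (y_part u = y_part v \<and> ltx (x_part u) (x_part v))"

text \<open>The value of \<open>p\<close> under the ring homomorphism that is \<open>c\<close> on coefficients and sends the
  variable \<open>v\<close> to \<open>g v\<close>.\<close>

definition eval_hom ::
    "('k::field \<Rightarrow> 'a::comm_ring_1) \<Rightarrow> ('v \<Rightarrow> 'a) \<Rightarrow> ('v, 'k) mpoly \<Rightarrow> 'a" where
  "eval_hom c g p = (\<Sum>u\<in>Poly_Mapping.keys p. c (Poly_Mapping.lookup p u) *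
                       (\<Prod>v\<in>Poly_Mapping.keys u. g v ^ Poly_Mapping.lookup u v))"

text \<open>The map \<open>x\<^sub>i \<mapsto> x\<^sub>i\<close>, \<open>y\<^sub>j \<mapsto> f\<^sub>j t\<close> with values in \<open>S[t]\<close>, which contains the Rees ring; its
  kernel does not depend on whether \<open>S[t]\<close> or the Rees ring is taken as codomain.\<close>

definition rees_map ::
    "(nat \<Rightarrow> 'x mon) \<Rightarrow> ('x + nat, 'k::field) mpoly \<Rightarrow> ('x, 'k) mpoly poly" where
  "rees_map f = eval_hom (\<lambda>a. [:Poly_Mapping.single 0 a:])
     (case_sum (\<lambda>i. [:pmon (Poly_Mapping.single i 1):]) (\<lambda>j. monom (pmon (f j)) 1))"

definition rees_ideal :: "nat \<Rightarrow> (nat \<Rightarrow> 'x mon) \<Rightarrow> ('x + nat, 'k::field) mpoly set" where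
  "rees_ideal m f = {p \<in> polys_in (T_vars m). rees_map f p = 0}"


section \<open>Graded modules, linear resolutions, componentwise linearity\<close>

text \<open>
  A graded \<open>S\<close>-module is given by the action \<open>scale\<close> of \<open>S\<close>, the underlying submodule \<open>M\<close> of the
  ambient type, and a family \<open>G\<close> for which \<open>M \<inter> G d\<close> is the component of \<open>M\<close> of degree \<open>d\<close>.
  Thus a homogeneous ideal of \<open>S\<close> has \<open>scale = (*)\<close> and \<open>G d = {p. homogeneous d p}\<close>.
\<close>

definition graded_module ::
    "(('x, 'k::field) mpoly \<Rightarrow> 'b::ab_group_add \<Rightarrow> 'b) \<Rightarrow> (int \<Rightarrow> 'b set) \<Rightarrow> 'b set \<Rightarrow> bool" where
  "graded_module scale G M \<longleftrightarrow>
     module scale \<and> module.subspace scale M \<and>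
     (\<forall>d. 0 \<in> M \<inter> G d \<and> (\<forall>a \<in> M \<inter> G d. \<forall>b \<in> M \<inter> G d. a - b \<in> G d)) \<and>
     (\<forall>e d p. homogeneous e p \<longrightarrow> (\<forall>a \<in> M \<inter> G d. scale p a \<in> G (e + d))) \<and>
     (\<forall>a\<in>M. \<exists>!c. finite {d. c d \<noteq> 0} \<and> (\<forall>d. c d \<in> M \<inter> G d) \<and> a = (\<Sum>d | c d \<noteq> 0. c d))"

definition free_vecs :: "nat \<Rightarrow> (nat \<Rightarrow> 'a::zero) set" where
  "free_vecs b = {v. \<forall>j\<ge>b. v j = 0}"

definition mat_apply ::
    "nat \<Rightarrow> nat \<Rightarrow> (nat \<Rightarrow> nat \<Rightarrow> 'a::comm_ring_1) \<Rightarrow> (nat \<Rightarrow> 'a) \<Rightarrow> nat \<Rightarrow> 'a" where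
  "mat_apply r c A v = (\<lambda>i. if i < r then (\<Sum>j<c. A i j * v j) else 0)"

definition lin_comb ::
    "('a \<Rightarrow> 'b \<Rightarrow> 'b::ab_group_add) \<Rightarrow> nat \<Rightarrow> (nat \<Rightarrow> 'b) \<Rightarrow> (nat \<Rightarrow> 'a) \<Rightarrow> 'b" where
  "lin_comb scale b e v = (\<Sum>j<b. scale (v j) (e j))"

text \<open>
  A graded free resolution \<open>\<dots> \<rightarrow> F\<^sub>1 \<rightarrow> F\<^sub>0 \<rightarrow> M \<rightarrow> 0\<close> by free modules of finite rank with degree-preserving
  maps: \<open>F\<^sub>i\<close> is the direct sum of the \<open>S(- s i j)\<close> for \<open>j < b i\<close>, so its \<open>j\<close>-th basis vector has
  degree \<open>s i j\<close>; the matrix \<open>D i\<close> describes \<open>F\<^bsub>i+1\<^esub> \<rightarrow> F\<^sub>i\<close>, and \<open>e\<close> lists the images of the basis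
  of \<open>F\<^sub>0\<close> in \<open>M\<close>.
\<close>

definition graded_free_resolution ::
    "(('x, 'k::field) mpoly \<Rightarrow> 'b::ab_group_add \<Rightarrow> 'b) \<Rightarrow> (int \<Rightarrow> 'b set) \<Rightarrow> 'b set \<Rightarrow>
     (nat \<Rightarrow> nat) \<Rightarrow> (nat \<Rightarrow> nat \<Rightarrow> int) \<Rightarrow> (nat \<Rightarrow> 'b) \<Rightarrow>
     (nat \<Rightarrow> nat \<Rightarrow> nat \<Rightarrow> ('x, 'k) mpoly) \<Rightarrow> bool" where
  "graded_free_resolution scale G M b s e D \<longleftrightarrow>
     (\<forall>j < b 0. e j \<in> M \<inter> G (s 0 j)) \<and>
     (\<forall>i. \<forall>r < b i. \<forall>c < b (Suc i). homogeneous (s (Suc i) c - s i r) (D i r c)) \<and>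
     lin_comb scale (b 0) e ` free_vecs (b 0) = M \<and>
     {v \<in> free_vecs (b 0). lin_comb scale (b 0) e v = 0}
       = mat_apply (b 0) (b 1) (D 0) ` free_vecs (b 1) \<and>
     (\<forall>i. {v \<in> free_vecs (b (Suc i)). mat_apply (b i) (b (Suc i)) (D i) v = (\<lambda>_. 0)}
       = mat_apply (b (Suc i)) (b (Suc (Suc i))) (D (Suc i)) ` free_vecs (b (Suc (Suc i))))"

text \<open>Minimality: all entries of the matrices \<open>D i\<close> lie in \<open>(x\<^sub>1,\<dots>,x\<^sub>n)\<close>, i.e. have constant term \<open>0\<close>.\<close>

definition minimal_graded_free_resolution ::
    "(('x, 'k::field) mpoly \<Rightarrow> 'b::ab_group_add \<Rightarrow> 'b) \<Rightarrow> (int \<Rightarrow> 'b set) \<Rightarrow> 'b set \<Rightarrow>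
     (nat \<Rightarrow> nat) \<Rightarrow> (nat \<Rightarrow> nat \<Rightarrow> int) \<Rightarrow> (nat \<Rightarrow> 'b) \<Rightarrow>
     (nat \<Rightarrow> nat \<Rightarrow> nat \<Rightarrow> ('x, 'k) mpoly) \<Rightarrow> bool" where
  "minimal_graded_free_resolution scale G M b s e D \<longleftrightarrow>
     graded_free_resolution scale G M b s e D \<and>
     (\<forall>i. \<forall>r < b i. \<forall>c < b (Suc i). Poly_Mapping.lookup (D i r c) 0 = 0)"

text \<open>Here \<open>F\<^sub>i\<close> is a direct sum of copies of \<open>S(-d-i)\<close>. The zero module qualifies, with all ranks \<open>0\<close>.\<close>

definition has_linear_resolution ::
    "(('x, 'k::field) mpoly \<Rightarrow> 'b::ab_group_add \<Rightarrow> 'b) \<Rightarrow> (int \<Rightarrow> 'b set) \<Rightarrow> 'b set \<Rightarrow> bool" where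
  "has_linear_resolution scale G M \<longleftrightarrow>
     (\<exists>d b s e D. minimal_graded_free_resolution scale G M b s e D \<and>
        (\<forall>i. \<forall>j < b i. s i j = d + int i))"

definition componentwise_linear ::
    "(('x, 'k::field) mpoly \<Rightarrow> 'b::ab_group_add \<Rightarrow> 'b) \<Rightarrow> (int \<Rightarrow> 'b set) \<Rightarrow> 'b set \<Rightarrow> bool" where
  "componentwise_linear scale G M \<longleftrightarrow>
     graded_module scale G M \<and>
     (\<forall>k. has_linear_resolution scale G (module.span scale (M \<inter> G k)))"

end

theory Submission
  imports Defs
begin

text \<open>
  Write \<open>f\<^sup>w\<close> for the product of the generators with exponents \<open>w\<close>. The ideal \<open>J\<close> contains exactly
  the polynomials whose coefficients cancel along each fibre of \<open>x\<^sup>c y\<^sup>w \<mapsto> x\<^sup>c f\<^sup>w t\<^bsup>deg w\<^esup>\<close>, so \<open>x\<^sup>c y\<^sup>w\<close>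
  is an initial monomial iff some \<open>y\<^sup>v\<close> with \<open>deg v = deg w\<close> is smaller than \<open>y\<^sup>w\<close> and satisfies
  \<open>f\<^sup>v | x\<^sup>c f\<^sup>w\<close> (\<open>initial_mons_rees_ideal\<close>). That the initial ideal is quadratic then says: whenever
  \<open>x\<^sup>c y\<^sup>w\<close> is initial, it has an initial divisor of the form \<open>x\<^sub>l y\<^sub>s\<close> or \<open>y\<^sub>s y\<^sub>t\<close>; a divisor in the
  \<open>x\<^sub>i\<close> alone is never initial (\<open>quadratic_initial_ideal\<close>, \<open>mixed_or_yy\<close>).

  Call \<open>w\<close> standard if \<open>y\<^sup>w\<close> is not initial. The minimal generators of \<open>I\<^sup>k\<close> are the \<open>f\<^sup>w\<close> with \<open>w\<close>
  standard of degree \<open>k\<close>: every \<open>f\<^sup>v\<close> is a multiple of one of these by a descent in \<open><'\<close>, and none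
  divides another (\<open>standard_minimal\<close>). For the latter suppose \<open>f\<^sup>w = x\<^sup>c f\<^sup>v\<close> with \<open>c \<noteq> 0\<close> and \<open>v\<close>
  least possible. As \<open>w\<close> is standard, \<open>w <' v\<close>, so \<open>x\<^sup>c y\<^sup>v\<close> is initial and can be reduced by a
  quadratic binomial. This makes \<open>v\<close> smaller, and the new power of \<open>x\<close> is still nontrivial, because
  in a relation \<open>x\<^sub>l f\<^sub>s = x\<^sup>a f\<^sub>t\<close> with \<open>s \<noteq> t\<close> the minimality of the generators forces \<open>a \<noteq> 0\<close>.

  Order these generators by \<open><'\<close> on their standard exponents. If \<open>v <' w\<close> are standard and \<open>x\<^sup>c\<close> is
  the generator \<open>f\<^sup>v / gcd(f\<^sup>v, f\<^sup>w)\<close> of the colon ideal, then \<open>x\<^sup>c y\<^sup>w\<close> is initial. Since \<open>w\<close> is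
  standard, the initial divisor is \<open>x\<^sub>l y\<^sub>s\<close>, so \<open>x\<^sub>l f\<^sup>w\<close> is a multiple of an earlier generator and
  \<open>x\<^sub>l | x\<^sup>c\<close>. Thus the colon ideals are generated by variables (\<open>standard_lin_quot\<close>).

  Componentwise linearity follows from linear quotients in two steps. The monomials of degree \<open>q\<close> in
  an ideal with linear quotients can again be ordered with linear quotients
  (\<open>deg_part_lin_quot_order\<close>). And for a sequence of vectors of equal degree with linear quotients, a
  generating set of the syzygies is again such a sequence, with linear entries (\<open>syzygies_lin_quot\<close>);
  iterating this builds a linear resolution.
\<close>

section \<open>Monomials and monomial ideals\<close>

definition mon_dvd :: "'v mon \<Rightarrow> 'v mon \<Rightarrow> bool" (infix \<open>\<preceq>\<close> 50) where
  "u \<preceq> v \<longleftrightarrow> (\<forall>x. Poly_Mapping.lookup u x \<le> Poly_Mapping.lookup v x)"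

lemma mon_dvd_refl [simp]: "u \<preceq> u"
  by (simp add: mon_dvd_def)

lemma mon_dvd_trans [trans]: "u \<preceq> v \<Longrightarrow> v \<preceq> w \<Longrightarrow> u \<preceq> w"
  by (auto simp: mon_dvd_def intro: order_trans)

lemma mon_dvd_add [simp]: "u \<preceq> u + v" "u \<preceq> v + u"
  by (simp_all add: mon_dvd_def lookup_add)

lemma zero_mon_dvd [simp]: "0 \<preceq> u"
  by (simp add: mon_dvd_def)

lemma mon_dvd_add_diff: "u \<preceq> v \<Longrightarrow> u + (v - u) = v"
  by (rule poly_mapping_eqI) (simp add: mon_dvd_def lookup_add lookup_minus)

lemma mon_dvdE:
  assumes "u \<preceq> v"
  obtains w where "v = u + w"
  using mon_dvd_add_diff[OF assms] by metis

lemma mon_dvd_add_right_cancel [simp]: "u + w \<preceq> v + w \<longleftrightarrow> u \<preceq> v"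
  by (simp add: mon_dvd_def lookup_add)

lemma single_mon_dvd_iff: "Poly_Mapping.single x 1 \<preceq> u \<longleftrightarrow> Poly_Mapping.lookup u x \<noteq> 0"
  by (auto simp: mon_dvd_def lookup_single when_def Suc_le_eq)

lemma keys_add_mon: "Poly_Mapping.keys (u + v) = Poly_Mapping.keys u \<union> Poly_Mapping.keys (v :: 'v mon)"
  by (auto simp: in_keys_iff lookup_add)

lemma deg_superset:
  assumes "finite A" "Poly_Mapping.keys u \<subseteq> A"
  shows "deg u = (\<Sum>v\<in>A. Poly_Mapping.lookup u v)"
  unfolding deg_def using assms by (intro sum.mono_neutral_left) (auto simp: in_keys_iff)

lemma deg_add [simp]: "deg (u + v) = deg u + deg v"
proof -
  let ?A = "Poly_Mapping.keys u \<union> Poly_Mapping.keys v"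
  have "deg w = (\<Sum>v\<in>?A. Poly_Mapping.lookup w v)" if "Poly_Mapping.keys w \<subseteq> ?A" for w
    using that by (intro deg_superset) auto
  then show ?thesis by (simp add: keys_add_mon lookup_add sum.distrib)
qed

lemma deg_zero [simp]: "deg 0 = 0"
  by (simp add: deg_def)

lemma deg_single [simp]: "deg (Poly_Mapping.single x n) = n"
  by (simp add: deg_def)

lemma deg_eq_0_iff [simp]: "deg u = 0 \<longleftrightarrow> u = 0"
  by (auto simp: deg_def in_keys_iff intro!: poly_mapping_eqI)

lemma mon_dvd_deg_eq: "u \<preceq> v \<Longrightarrow> deg v \<le> deg u \<Longrightarrow> u = v"
  by (auto elim!: mon_dvdE)

lemma nonzero_monE:
  assumes "u \<noteq> 0"
  obtains x where "Poly_Mapping.lookup u x \<noteq> (0::nat)"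
  using assms by (metis poly_mapping_eqI lookup_zero)

lemma deg_1E:
  assumes "deg u = 1"
  obtains x where "u = Poly_Mapping.single x 1"
proof -
  from assms have "u \<noteq> 0" by auto
  then obtain x where "Poly_Mapping.lookup u x \<noteq> 0" by (rule nonzero_monE)
  then have "Poly_Mapping.single x 1 \<preceq> u" by (simp only: single_mon_dvd_iff not_False_eq_True)
  then show ?thesis using assms that mon_dvd_deg_eq[of "Poly_Mapping.single x 1" u] by auto
qed

lemma finite_mons_of_deg:
  assumes "finite V"
  shows "finite {u \<in> mons_in V. deg u = k}"
proof (induction k)
  case 0
  have "{u \<in> mons_in V. deg u = 0} \<subseteq> {0}" by auto
  then show ?case by (rule finite_subset) simp
next
  case (Suc k)
  let ?B = "(\<lambda>(u, x). u + Poly_Mapping.single x 1) ` ({u \<in> mons_in V. deg u = k} \<times> V)"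
  have "u \<in> ?B" if u: "u \<in> mons_in V" "deg u = Suc k" for u
  proof -
    from u(2) have "u \<noteq> 0" by auto
    then obtain x where x: "Poly_Mapping.lookup u x \<noteq> 0" by (rule nonzero_monE)
    then have "Poly_Mapping.single x 1 \<preceq> u" by (simp only: single_mon_dvd_iff not_False_eq_True)
    then obtain w where w: "u = Poly_Mapping.single x 1 + w" by (rule mon_dvdE)
    have "w \<in> mons_in V" "x \<in> V" "deg w = k"
      using u w by (auto simp: mons_in_def keys_add_mon)
    then show ?thesis using w by (auto intro!: image_eqI[of _ _ "(w, x)"] simp: add.commute)
  qed
  then have "{u \<in> mons_in V. deg u = Suc k} \<subseteq> ?B" by auto
  moreover have "finite ?B" using Suc assms by auto
  ultimately show ?case by (rule finite_subset)
qed

lemma mons_in_UNIV [simp]: "mons_in UNIV = UNIV"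
  by (simp add: mons_in_def)

lemma module_mult: "module ((*) :: 'a::comm_ring_1 \<Rightarrow> 'a \<Rightarrow> 'a)"
  by unfold_locales (simp_all add: algebra_simps)

lemma sum_singles: "p = (\<Sum>u\<in>Poly_Mapping.keys p. Poly_Mapping.single u (Poly_Mapping.lookup p u))"
  by (rule poly_mapping_eqI)
    (auto simp: lookup_sum lookup_single when_def not_in_keys_iff_lookup_eq_zero)

lemma keys_pmon [simp]: "Poly_Mapping.keys (pmon u :: ('v, 'k::field) mpoly) = {u}"
  by (simp add: pmon_def)

lemma pmon_add: "pmon (u + v) = pmon u * pmon v"
  by (simp add: pmon_def mult_single)

lemma pmon_zero [simp]: "pmon 0 = 1"
  by (simp add: pmon_def)

lemma lookup_times_pmon:
  fixes p :: "('v, 'k::field) mpoly"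
  shows "Poly_Mapping.lookup (p * pmon u) v = (\<Sum>w\<in>Poly_Mapping.keys p. if w + u = v then Poly_Mapping.lookup p w else 0)"
proof -
  have "p * pmon u = (\<Sum>w\<in>Poly_Mapping.keys p. Poly_Mapping.single (w + u) (Poly_Mapping.lookup p w))"
    by (subst sum_singles[of p]) (simp add: sum_distrib_right pmon_def mult_single)
  then show ?thesis by (simp add: lookup_sum lookup_single when_def)
qed

lemma keys_times_pmon:
  fixes p :: "('v, 'k::field) mpoly"
  shows "Poly_Mapping.keys (p * pmon u) = (\<lambda>w. w + u) ` Poly_Mapping.keys p"
proof -
  have *: "Poly_Mapping.lookup (p * pmon u) (w + u) = Poly_Mapping.lookup p w" for w
    by (auto simp: lookup_times_pmon not_in_keys_iff_lookup_eq_zero)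
  show ?thesis
  proof (intro subset_antisym subsetI)
    fix v assume v: "v \<in> Poly_Mapping.keys (p * pmon u)"
    then have "\<exists>w\<in>Poly_Mapping.keys p. w + u = v"
      by (rule contrapos_pp) (simp add: in_keys_iff lookup_times_pmon cong: if_cong)
    then show "v \<in> (\<lambda>w. w + u) ` Poly_Mapping.keys p" by auto
  qed (auto simp: in_keys_iff *)
qed

definition monomial_ideal :: "'v mon set \<Rightarrow> ('v, 'k::field) mpoly set" where
  "monomial_ideal G = {p. \<forall>u\<in>Poly_Mapping.keys p. \<exists>g\<in>G. g \<preceq> u}"

lemma subspace_monomial_ideal:
  "module.subspace (*) (monomial_ideal G :: ('v, 'k::field) mpoly set)"
  unfolding module.subspace_def[OF module_mult]
proof (intro conjI ballI allI)
  fix p q :: "('v, 'k) mpoly" assume "p \<in> monomial_ideal G" "q \<in> monomial_ideal G"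
  then show "p + q \<in> monomial_ideal G"
    using keys_add[of p q] by (auto simp: monomial_ideal_def)
next
  fix c p :: "('v, 'k) mpoly" assume p: "p \<in> monomial_ideal G"
  show "c * p \<in> monomial_ideal G"
    unfolding monomial_ideal_def
  proof (intro CollectI ballI)
    fix u assume "u \<in> Poly_Mapping.keys (c * p)"
    then obtain a b where "b \<in> Poly_Mapping.keys p" "u = a + b" using keys_mult[of c p] by auto
    moreover from this obtain g where "g \<in> G" "g \<preceq> b" using p by (auto simp: monomial_ideal_def)
    ultimately show "\<exists>g\<in>G. g \<preceq> u" using mon_dvd_trans mon_dvd_add(2) by blast
  qed
qed (simp add: monomial_ideal_def)

lemma ideal_span_pmon:
  "ideal_span (pmon ` G) = (monomial_ideal G :: ('v, 'k::field) mpoly set)"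
proof (rule module.span_unique[OF module_mult _ subspace_monomial_ideal])
  show "pmon ` G \<subseteq> (monomial_ideal G :: ('v, 'k) mpoly set)"
    by (auto simp: monomial_ideal_def intro: mon_dvd_refl)
  fix T :: "('v, 'k) mpoly set"
  assume T: "pmon ` G \<subseteq> T" "module.subspace (*) T"
  have "p \<in> T" if p: "p \<in> monomial_ideal G" for p
  proof -
    have "Poly_Mapping.single u c \<in> T" if "u \<in> Poly_Mapping.keys p" for u c
    proof -
      from p that obtain g where g: "g \<in> G" "g \<preceq> u" by (auto simp: monomial_ideal_def)
      have "Poly_Mapping.single u c = Poly_Mapping.single (u - g) c * pmon g"
        using mon_dvd_add_diff[OF g(2)] by (simp add: pmon_def mult_single add.commute)
      also have "\<dots> \<in> T"
        using T g by (intro module.subspace_scale[OF module_mult]) auto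
      finally show ?thesis .
    qed
    then have "(\<Sum>u\<in>Poly_Mapping.keys p. Poly_Mapping.single u (Poly_Mapping.lookup p u)) \<in> T"
      by (intro module.subspace_sum[OF module_mult T(2)])
    then show ?thesis by (simp flip: sum_singles)
  qed
  then show "monomial_ideal G \<subseteq> T" by auto
qed

lemma pmon_in_monomial_ideal [simp]:
  "(pmon u :: ('v, 'k::field) mpoly) \<in> monomial_ideal G \<longleftrightarrow> (\<exists>g\<in>G. g \<preceq> u)"
  by (simp add: monomial_ideal_def)

lemma monomial_ideal_mono_dvd:
  assumes "\<And>g. g \<in> G \<Longrightarrow> \<exists>h\<in>H. h \<preceq> g"
  shows "monomial_ideal G \<subseteq> (monomial_ideal H :: ('v, 'k::field) mpoly set)"
proof
  fix p :: "('v, 'k) mpoly" assume "p \<in> monomial_ideal G"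
  then show "p \<in> monomial_ideal H"
    using assms mon_dvd_trans unfolding monomial_ideal_def by blast
qed

text \<open>
  Minimality under inclusion turns into a divisibility condition, since a generator is redundant
  exactly when another one divides it.
\<close>

lemma minimal_monomial_generators_iff:
  fixes I :: "('v, 'k::field) mpoly set"
  shows "minimal_monomial_generators G I \<longleftrightarrow>
    I = monomial_ideal G \<and> (\<forall>g\<in>G. \<forall>h\<in>G. g \<preceq> h \<longrightarrow> g = h)"
proof (intro iffI conjI ballI impI)
  assume min: "minimal_monomial_generators G I"
  then show I: "I = monomial_ideal G"
    by (simp add: minimal_monomial_generators_def ideal_span_pmon)
  fix g h assume gh: "g \<in> G" "h \<in> G" "g \<preceq> h"
  show "g = h"
  proof (rule ccontr)
    assume "g \<noteq> h"
    then have g: "g \<in> G - {h}" using gh by auto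
    have "\<exists>u\<in>G - {h}. u \<preceq> v" if "v \<in> G" for v
    proof (cases "v = h")
      case True
      then show ?thesis using g gh by blast
    next
      case False
      then show ?thesis using that mon_dvd_refl by blast
    qed
    then have "monomial_ideal G \<subseteq> (monomial_ideal (G - {h}) :: ('v, 'k) mpoly set)"
      by (rule monomial_ideal_mono_dvd)
    moreover have "monomial_ideal (G - {h}) \<subseteq> (monomial_ideal G :: ('v, 'k) mpoly set)"
      by (rule monomial_ideal_mono_dvd) (use mon_dvd_refl in blast)
    ultimately have "ideal_span (pmon ` (G - {h})) = I" by (simp add: ideal_span_pmon I)
    moreover have "G - {h} \<subset> G" using gh by auto
    ultimately show False using min by (auto simp: minimal_monomial_generators_def)
  qed
next
  assume *: "I = monomial_ideal G \<and> (\<forall>g\<in>G. \<forall>h\<in>G. g \<preceq> h \<longrightarrow> g = h)"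
  show "minimal_monomial_generators G I"
    unfolding minimal_monomial_generators_def
  proof (intro conjI allI impI)
    show "ideal_span (pmon ` G) = I" using * by (simp add: ideal_span_pmon)
    fix G' assume "G' \<subset> G"
    then obtain g where g: "g \<in> G" "g \<notin> G'" by auto
    have "pmon g \<in> I" using * g by (auto intro: mon_dvd_refl)
    moreover have "(pmon g :: ('v, 'k) mpoly) \<notin> monomial_ideal G'"
      using * g \<open>G' \<subset> G\<close> by auto
    ultimately show "ideal_span (pmon ` G') \<noteq> I" by (auto simp: ideal_span_pmon)
  qed
qed

section \<open>Homogeneous components\<close>

definition hom_comp :: "int \<Rightarrow> ('v, 'k::field) mpoly \<Rightarrow> ('v, 'k) mpoly" where
  "hom_comp d p = (\<Sum>u | u \<in> Poly_Mapping.keys p \<and> int (deg u) = d.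
      Poly_Mapping.single u (Poly_Mapping.lookup p u))"

lemma lookup_hom_comp:
  "Poly_Mapping.lookup (hom_comp d p) u = (if int (deg u) = d then Poly_Mapping.lookup p u else 0)"
  by (auto simp: hom_comp_def lookup_sum lookup_single when_def
        not_in_keys_iff_lookup_eq_zero)

lemma hom_comp_sum: "hom_comp d (sum p A) = (\<Sum>a\<in>A. hom_comp d (p a))"
  by (rule poly_mapping_eqI) (simp add: lookup_hom_comp lookup_sum)

lemma homogeneous_lookup: "homogeneous d p \<longleftrightarrow> (\<forall>u. Poly_Mapping.lookup p u \<noteq> 0 \<longrightarrow> int (deg u) = d)"
  by (auto simp: homogeneous_def in_keys_iff)

lemma homogeneous_hom_comp: "homogeneous d (hom_comp d p)"
  by (simp add: homogeneous_lookup lookup_hom_comp)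

lemma hom_comp_homogeneous: "homogeneous d p \<Longrightarrow> hom_comp e p = (if e = d then p else 0)"
  by (rule poly_mapping_eqI) (auto simp: homogeneous_lookup lookup_hom_comp)

lemma homogeneous_mult: 
  assumes "homogeneous d p" "homogeneous e q"
  shows "homogeneous (d + e) (p * q)"
  unfolding homogeneous_def
proof
  fix u assume "u \<in> Poly_Mapping.keys (p * q)"
  then obtain a b where "a \<in> Poly_Mapping.keys p" "b \<in> Poly_Mapping.keys q" "u = a + b"
    using keys_mult[of p q] by auto
  then show "int (deg u) = d + e" using assms by (simp add: homogeneous_def)
qed

lemma homogeneous_pmon [simp]: "homogeneous d (pmon u :: ('v, 'k::field) mpoly) \<longleftrightarrow> int (deg u) = d"
  by (simp add: homogeneous_def)

lemma homogeneous_zero [simp]: "homogeneous d 0"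
  by (simp add: homogeneous_def)

lemma homogeneous_uminus: "homogeneous d p \<Longrightarrow> homogeneous d (- p)"
  by (simp add: homogeneous_lookup)

lemma homogeneous_diff: "homogeneous d p \<Longrightarrow> homogeneous d q \<Longrightarrow> homogeneous d (p - q)"
  unfolding homogeneous_lookup lookup_minus by (metis diff_self)

text \<open>
  Both sides are additive in \<open>p\<close>, so it is enough to compare them on a single term.
\<close>

lemma hom_comp_mult:
  assumes "homogeneous d q"
  shows "hom_comp (e + d) (p * q) = hom_comp e p * q"
proof -
  let ?s = "\<lambda>u. Poly_Mapping.single u (Poly_Mapping.lookup p u)"
  have "hom_comp (e + d) (?s u * q) = hom_comp e (?s u) * q" for u
  proof -
    have s: "homogeneous (int (deg u)) (?s u)" by (simp add: homogeneous_lookup lookup_single when_def)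
    show ?thesis
      using hom_comp_homogeneous[OF s, of e]
        hom_comp_homogeneous[OF homogeneous_mult[OF s assms], of "e + d"] by auto
  qed
  then have "hom_comp (e + d) ((\<Sum>u\<in>Poly_Mapping.keys p. ?s u) * q)
      = hom_comp e (\<Sum>u\<in>Poly_Mapping.keys p. ?s u) * q"
    by (simp add: sum_distrib_right hom_comp_sum)
  then show ?thesis by (simp flip: sum_singles)
qed

section \<open>Linear resolutions from linear quotients\<close>

definition var_ideal :: "'x set \<Rightarrow> ('x, 'k::field) mpoly set" where
  "var_ideal X = monomial_ideal ((\<lambda>x. Poly_Mapping.single x 1) ` X)"

lemma mem_var_ideal:
  "p \<in> var_ideal X \<longleftrightarrow> (\<forall>u\<in>Poly_Mapping.keys p. \<exists>x\<in>X. Poly_Mapping.lookup u x \<noteq> 0)"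
  by (simp add: var_ideal_def monomial_ideal_def single_mon_dvd_iff del: One_nat_def)

lemma var_ideal_span: "var_ideal X = ideal_span (pmon ` (\<lambda>x. Poly_Mapping.single x 1) ` X)"
  by (simp only: var_ideal_def ideal_span_pmon)

lemma var_ideal_empty: "var_ideal {} = {0}"
  by (auto simp: mem_var_ideal)

lemma mem_var_ideal_insert:
  "q \<in> var_ideal (insert x X) \<longleftrightarrow>
    (\<exists>p. q - p * pmon (Poly_Mapping.single x 1) \<in> var_ideal X)"
  by (simp only: var_ideal_span image_insert module.span_breakdown_eq[OF module_mult])

text \<open>
  A new variable is a nonzerodivisor modulo the ideal generated by the others. This supplies the
  colon ideals between the syzygies that belong to the same vector.
\<close>

lemma var_ideal_colon_var:
  fixes p :: "('x, 'k::field) mpoly"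
  assumes "x \<notin> X"
  shows "p * pmon (Poly_Mapping.single x 1) \<in> var_ideal X \<longleftrightarrow> p \<in> var_ideal X"
proof -
  have "Poly_Mapping.lookup (w + Poly_Mapping.single x 1) y = Poly_Mapping.lookup w y"
    if "y \<in> X" for w :: "'x mon" and y
    using that assms by (auto simp: lookup_add lookup_single when_def)
  then show ?thesis by (simp add: mem_var_ideal keys_times_pmon del: One_nat_def)
qed

text \<open>
  The vectors of \<open>es\<close> are the columns of a matrix, and \<open>vec_comb es\<close> is the map it defines.
\<close>

definition vec_comb :: "(nat \<Rightarrow> 'a::comm_ring_1) list \<Rightarrow> (nat \<Rightarrow> 'a) \<Rightarrow> nat \<Rightarrow> 'a" where
  "vec_comb es v = (\<lambda>i. \<Sum>j<length es. (es ! j) i * v j)"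

definition vec_span :: "(nat \<Rightarrow> 'a::comm_ring_1) list \<Rightarrow> (nat \<Rightarrow> 'a) set" where
  "vec_span es = range (vec_comb es)"

definition syzygies :: "(nat \<Rightarrow> 'a::comm_ring_1) list \<Rightarrow> (nat \<Rightarrow> 'a) set" where
  "syzygies es = {v \<in> free_vecs (length es). vec_comb es v = (\<lambda>_. 0)}"

lemma vec_comb_snoc: "vec_comb (es @ [e]) v i = vec_comb es v i + e i * v (length es)"
  by (simp add: vec_comb_def nth_append)

lemma vec_comb_cong: "(\<And>j. j < length es \<Longrightarrow> v j = w j) \<Longrightarrow> vec_comb es v = vec_comb es w"
  by (simp add: vec_comb_def)

lemma vec_comb_free_vecs: "vec_span es = vec_comb es ` free_vecs (length es)"
proof -
  have "vec_comb es v \<in> vec_comb es ` free_vecs (length es)" for v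
    by (rule image_eqI[where x = "\<lambda>j. if j < length es then v j else 0"])
      (auto simp: free_vecs_def intro: vec_comb_cong)
  then show ?thesis by (auto simp: vec_span_def)
qed

lemma vec_span_Nil: "vec_span [] = {\<lambda>_. 0}"
  by (auto simp: vec_span_def vec_comb_def)

lemma mem_vec_span_snoc:
  "w \<in> vec_span (es @ [e]) \<longleftrightarrow> (\<exists>p. (\<lambda>i. w i - p * e i) \<in> vec_span es)"
proof
  assume "w \<in> vec_span (es @ [e])"
  then obtain v where "w = vec_comb (es @ [e]) v" by (auto simp: vec_span_def)
  then have "(\<lambda>i. w i - v (length es) * e i) = vec_comb es v"
    by (simp add: vec_comb_snoc fun_eq_iff)
  then show "\<exists>p. (\<lambda>i. w i - p * e i) \<in> vec_span es" by (auto simp: vec_span_def)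
next
  assume "\<exists>p. (\<lambda>i. w i - p * e i) \<in> vec_span es"
  then obtain p v where pv: "(\<lambda>i. w i - p * e i) = vec_comb es v" by (auto simp: vec_span_def)
  have "w = vec_comb (es @ [e]) (v(length es := p))"
  proof
    fix i
    have "vec_comb es (v(length es := p)) = vec_comb es v" by (rule vec_comb_cong) simp
    then show "w i = vec_comb (es @ [e]) (v(length es := p)) i"
      using fun_cong[OF pv, of i] by (simp add: vec_comb_snoc algebra_simps)
  qed
  then show "w \<in> vec_span (es @ [e])" by (auto simp: vec_span_def)
qed

text \<open>
  The vectors are elements of a free module of rank \<open>r\<close> with entries of degree \<open>d\<close>. The colon ideal of each
  one with respect to the submodule generated by its predecessors is generated by variables.
\<close>

inductive vec_lin_quot :: "nat \<Rightarrow> int \<Rightarrow> (nat \<Rightarrow> ('x, 'k::field) mpoly) list \<Rightarrow> bool"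
  for r d where
  Nil: "vec_lin_quot r d []"
| snoc: "vec_lin_quot r d es \<Longrightarrow> e \<in> free_vecs r \<Longrightarrow> (\<And>i. homogeneous d (e i)) \<Longrightarrow>
    (\<And>p. (\<lambda>i. p * e i) \<in> vec_span es \<longleftrightarrow> p \<in> var_ideal X) \<Longrightarrow> vec_lin_quot r d (es @ [e])"

lemma vec_lin_quot_entries:
  "vec_lin_quot r d es \<Longrightarrow> e \<in> set es \<Longrightarrow> e \<in> free_vecs r \<and> homogeneous d (e i)"
  by (induction rule: vec_lin_quot.induct) auto

lemma vec_lin_quot_mono:
  assumes "vec_lin_quot r d es" "r \<le> r'"
  shows "vec_lin_quot r' d es"
  using assms(1)
proof induction
  case (snoc es e X)
  then show ?case using \<open>r \<le> r'\<close>
    by (intro vec_lin_quot.snoc[of _ _ _ _ X]) (auto simp: free_vecs_def)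
qed (rule vec_lin_quot.Nil)

text \<open>
  This is the step of the mapping cone construction, in a form that can be iterated. Adding a vector
  \<open>e\<close> with colon ideal \<open>(X)\<close> extends the syzygies by those whose last coefficient lies in \<open>(X)\<close>.
  They are filtered by the submodules \<open>N Y\<close>, \<open>Y \<subseteq> X\<close>, in which the last coefficient lies in \<open>(Y)\<close>.
  For \<open>x \<in> X\<close> there is a syzygy \<open>\<sigma>\<close> with last coefficient \<open>x\<close>, whose other coefficients may be chosen
  linear by passing to homogeneous components. Then \<open>N (insert x Y)\<close> is generated by \<open>N Y\<close> and \<open>\<sigma>\<close>,
  and the colon ideal of \<open>N Y\<close> with respect to \<open>\<sigma>\<close> is \<open>(Y) : x = (Y)\<close>.
\<close>

lemma syzygies_lin_quot:
  fixes es :: "(nat \<Rightarrow> ('x::finite, 'k::field) mpoly) list"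
  assumes "vec_lin_quot r d es"
  shows "\<exists>es'. vec_lin_quot (length es) 1 es' \<and> vec_span es' = syzygies es"
  using assms
proof induction
  case Nil
  have "syzygies [] = {\<lambda>_. 0 :: ('x, 'k) mpoly}"
    by (auto simp: syzygies_def free_vecs_def vec_comb_def)
  then show ?case by (intro exI[of _ "[]"]) (simp add: vec_span_Nil vec_lin_quot.Nil)
next
  case (snoc es e X)
  let ?n = "length es"
  define N where "N Y = {v \<in> syzygies (es @ [e]). v ?n \<in> var_ideal Y}" for Y :: "'x set"
  have syz: "v \<in> syzygies (es @ [e]) \<longleftrightarrow>
      v \<in> free_vecs (Suc ?n) \<and> (\<forall>i. vec_comb es v i + e i * v ?n = 0)" for v
    by (simp add: syzygies_def fun_eq_iff vec_comb_snoc)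
  have "\<exists>es'. vec_lin_quot (Suc ?n) 1 es' \<and> vec_span es' = N Y" if "Y \<subseteq> X" for Y
    using finite[of Y] that
  proof (induction Y rule: finite_induct)
    case empty
    from snoc.IH obtain es' where es': "vec_lin_quot ?n 1 es'" "vec_span es' = syzygies es" by auto
    have "v \<in> N {} \<longleftrightarrow> v \<in> syzygies es" for v
    proof -
      have "v \<in> free_vecs (Suc ?n) \<and> v ?n = 0 \<longleftrightarrow> v \<in> free_vecs ?n"
        by (auto simp: free_vecs_def Suc_le_eq) (metis le_neq_implies_less)
      moreover have "v \<in> N {} \<longleftrightarrow>
          (v \<in> free_vecs (Suc ?n) \<and> v ?n = 0) \<and> (\<forall>i. vec_comb es v i + e i * v ?n = 0)"
        by (auto simp: N_def syz var_ideal_empty)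
      moreover have "v \<in> syzygies es \<longleftrightarrow> v \<in> free_vecs ?n \<and> (\<forall>i. vec_comb es v i = 0)"
        by (auto simp: syzygies_def)
      moreover have "v ?n = 0" if "v \<in> free_vecs ?n" using that by (simp add: free_vecs_def)
      ultimately show ?thesis by auto
    qed
    then have "vec_span es' = N {}" using es' by auto
    then show ?case using es' vec_lin_quot_mono[of ?n 1 es' "Suc ?n"] by auto
  next
    case (insert x Y)
    then obtain es' where es': "vec_lin_quot (Suc ?n) 1 es'" "vec_span es' = N Y" by auto
    let ?x = "pmon (Poly_Mapping.single x 1) :: ('x, 'k) mpoly"
    have "?x \<in> var_ideal X" using insert.prems
      by (auto simp: mem_var_ideal lookup_single intro!: bexI[of _ x])
    then have "(\<lambda>i. ?x * e i) \<in> vec_span es" using snoc.hyps by auto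
    then obtain a where a: "\<And>i. ?x * e i = vec_comb es a i" by (force simp: vec_span_def fun_eq_iff)
    \<comment> \<open>Both sides of the relation are homogeneous of degree \<open>1 + d\<close>, so only the linear parts of the
      coefficients contribute to it.\<close>
    define a' where "a' j = hom_comp 1 (a j)" for j
    have a': "?x * e i = vec_comb es a' i" for i
    proof -
      have "hom_comp (1 + d) ((es ! j) i * a j) = (es ! j) i * a' j" if "j < ?n" for j
        using hom_comp_mult[of d "(es ! j) i" 1 "a j"] vec_lin_quot_entries[OF snoc.hyps(1), of "es ! j"] that
        by (simp add: a'_def mult.commute)
      then have "hom_comp (1 + d) (vec_comb es a i) = vec_comb es a' i"
        by (simp add: vec_comb_def hom_comp_sum)
      moreover have "homogeneous (1 + d) (?x * e i)"
        by (rule homogeneous_mult) (use snoc.hyps in simp_all)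
      ultimately show ?thesis by (simp add: hom_comp_homogeneous flip: a)
    qed
    define \<sigma> where "\<sigma> j = (if j < ?n then - a' j else if j = ?n then ?x else 0)" for j
    have \<sigma>n: "\<sigma> ?n = ?x" by (simp add: \<sigma>_def)
    have vc: "vec_comb es (\<lambda>j. w j - p * \<sigma> j) i = vec_comb es w i + p * (?x * e i)" for w p i
      unfolding a' by (simp add: vec_comb_def \<sigma>_def sum_distrib_left algebra_simps sum.distrib)
    have diff: "(\<lambda>j. w j - p * \<sigma> j) \<in> syzygies (es @ [e]) \<longleftrightarrow> w \<in> syzygies (es @ [e])" for w p
    proof -
      have "(\<lambda>j. w j - p * \<sigma> j) \<in> free_vecs (Suc ?n) \<longleftrightarrow> w \<in> free_vecs (Suc ?n)"
        by (auto simp: free_vecs_def \<sigma>_def)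
      then show ?thesis unfolding syz vc by (simp add: \<sigma>n algebra_simps)
    qed
    have zero: "(\<lambda>_. 0) \<in> syzygies (es @ [e])"
      by (simp add: syz free_vecs_def vec_comb_def)
    have mult: "(\<lambda>j. p * \<sigma> j) \<in> syzygies (es @ [e])" for p
      using diff[of "\<lambda>_. 0" "- p"] zero by simp
    have "vec_lin_quot (Suc ?n) 1 (es' @ [\<sigma>])"
    proof (rule vec_lin_quot.snoc[OF es'(1)])
      show "\<sigma> \<in> free_vecs (Suc ?n)" by (simp add: free_vecs_def \<sigma>_def)
      show "homogeneous 1 (\<sigma> i)" for i
        by (simp add: \<sigma>_def a'_def homogeneous_uminus homogeneous_hom_comp)
      show "(\<lambda>i. p * \<sigma> i) \<in> vec_span es' \<longleftrightarrow> p \<in> var_ideal Y" for p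
        using mult insert.hyps by (simp add: es' N_def \<sigma>n var_ideal_colon_var del: One_nat_def)
    qed
    moreover have "vec_span (es' @ [\<sigma>]) = N (insert x Y)"
      by (auto simp: mem_vec_span_snoc es' N_def diff \<sigma>n mem_var_ideal_insert)
    ultimately show ?case by blast
  qed
  then obtain es' where es': "vec_lin_quot (Suc ?n) 1 es'" "vec_span es' = N X" by blast
  have "v ?n \<in> var_ideal X" if "v \<in> syzygies (es @ [e])" for v
  proof -
    have "v ?n * e i = vec_comb es (\<lambda>j. - v j) i" for i
      using that by (simp add: syz vec_comb_def sum_negf mult.commute eq_neg_iff_add_eq_0 add.commute)
    then have "(\<lambda>i. v ?n * e i) \<in> vec_span es" by (simp add: vec_span_def)
    then show ?thesis using snoc.hyps by auto
  qed
  then have "N X = syzygies (es @ [e])" by (auto simp: N_def)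
  then show ?case using es' by auto
qed

text \<open>
  The colon ideal of \<open>gs ! j\<close> is generated by the monomials \<open>gs ! i / gcd(gs ! i, gs ! j)\<close> for \<open>i < j\<close>.
  The condition says that each of these is divisible by a variable of that colon ideal.
\<close>

definition lin_quot_list :: "'x mon list \<Rightarrow> bool" where
  "lin_quot_list gs \<longleftrightarrow> (\<forall>j<length gs. \<forall>i<j. \<exists>x.
     Poly_Mapping.lookup (gs ! j) x < Poly_Mapping.lookup (gs ! i) x \<and>
     (\<exists>i'<j. gs ! i' \<preceq> gs ! j + Poly_Mapping.single x 1))"

lemma colon_eq_var_ideal:
  fixes p :: "('x, 'k::field) mpoly"
  assumes "lin_quot_list gs" "j < length gs"
  shows "p * pmon (gs ! j) \<in> monomial_ideal (set (take j gs)) \<longleftrightarrow>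
    p \<in> var_ideal {x. \<exists>i<j. gs ! i \<preceq> gs ! j + Poly_Mapping.single x 1}" (is "_ \<longleftrightarrow> p \<in> var_ideal ?X")
proof -
  have set: "set (take j gs) = {gs ! i | i. i < j}"
    using assms(2) by (auto simp: nth_image[symmetric])
  have "(\<exists>g\<in>set (take j gs). g \<preceq> u + gs ! j) \<longleftrightarrow> (\<exists>x\<in>?X. Poly_Mapping.lookup u x \<noteq> 0)" for u
  proof
    assume "\<exists>g\<in>set (take j gs). g \<preceq> u + gs ! j"
    then obtain i where i: "i < j" "gs ! i \<preceq> u + gs ! j" by (auto simp: set)
    then obtain x where x: "Poly_Mapping.lookup (gs ! j) x < Poly_Mapping.lookup (gs ! i) x" "x \<in> ?X"
      using assms unfolding lin_quot_list_def by blast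
    from i(2) have "Poly_Mapping.lookup (gs ! i) x \<le> Poly_Mapping.lookup u x + Poly_Mapping.lookup (gs ! j) x"
      by (simp add: mon_dvd_def lookup_add)
    with x show "\<exists>x\<in>?X. Poly_Mapping.lookup u x \<noteq> 0" by (intro bexI[of _ x]) auto
  next
    assume "\<exists>x\<in>?X. Poly_Mapping.lookup u x \<noteq> 0"
    then obtain x i where x: "Poly_Mapping.single x 1 \<preceq> u" "i < j"
        "gs ! i \<preceq> Poly_Mapping.single x 1 + gs ! j"
      unfolding single_mon_dvd_iff by (auto simp: add.commute)
    then have "gs ! i \<preceq> u + gs ! j"
      by (meson mon_dvd_add_right_cancel mon_dvd_trans)
    then show "\<exists>g\<in>set (take j gs). g \<preceq> u + gs ! j" using x(2) by (auto simp: set)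
  qed
  then show ?thesis by (simp add: monomial_ideal_def mem_var_ideal keys_times_pmon)
qed

text \<open>
  Polynomials are embedded as vectors of rank one, to make the resolution of an ideal start with
  an instance of \<open>vec_lin_quot\<close>.
\<close>

lemma vec_span_monomials:
  fixes gs :: "'x mon list"
  shows "vec_span (map (\<lambda>g i. if i = 0 then pmon g else 0) gs) =
    {w :: nat \<Rightarrow> ('x, 'k::field) mpoly. w 0 \<in> monomial_ideal (set gs) \<and> (\<forall>i>0. w i = 0)}"
proof (induction gs rule: rev_induct)
  case Nil
  show ?case by (auto simp: vec_span_Nil monomial_ideal_def fun_eq_iff) (metis neq0_conv)
next
  case (snoc g gs)
  have "q \<in> monomial_ideal (insert g (set gs)) \<longleftrightarrow> (\<exists>p. q - p * pmon g \<in> monomial_ideal (set gs))"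
    for q :: "('x, 'k) mpoly"
    by (simp only: image_insert module.span_breakdown_eq[OF module_mult] flip: ideal_span_pmon)
  then show ?case
    by (intro set_eqI) (simp add: mem_vec_span_snoc snoc.IH)
qed

lemma vec_lin_quot_monomials:
  fixes gs :: "'x mon list"
  assumes lq: "lin_quot_list gs" and deg: "\<And>g. g \<in> set gs \<Longrightarrow> deg g = q"
  shows "vec_lin_quot 1 (int q) (map (\<lambda>g i. if i = 0 then pmon g else 0 :: ('x, 'k::field) mpoly) gs)"
    (is "vec_lin_quot 1 _ (map ?e gs)")
proof -
  have "vec_lin_quot 1 (int q) (map ?e (take j gs))" if "j \<le> length gs" for j
    using that
  proof (induction j)
    case 0
    show ?case by (simp add: vec_lin_quot.Nil)
  next
    case (Suc j)
    have "vec_lin_quot 1 (int q) (map ?e (take j gs) @ [?e (gs ! j)])"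
    proof (rule vec_lin_quot.snoc)
      show "vec_lin_quot 1 (int q) (map ?e (take j gs))" using Suc by simp
      show "?e (gs ! j) \<in> free_vecs 1" by (simp add: free_vecs_def)
      show "homogeneous (int q) (?e (gs ! j) i)" for i using deg Suc by simp
      show "(\<lambda>i. p * ?e (gs ! j) i) \<in> vec_span (map ?e (take j gs)) \<longleftrightarrow>
        p \<in> var_ideal {x. \<exists>i<j. gs ! i \<preceq> gs ! j + Poly_Mapping.single x 1}" for p
        using colon_eq_var_ideal[OF lq, of j p] Suc.prems by (simp add: vec_span_monomials)
    qed
    then show ?case using Suc.prems by (simp add: take_Suc_conv_app_nth)
  qed
  from this[of "length gs"] show ?thesis by simp
qed

text \<open>
  Start with the generators as vectors of rank one and take syzygies again and again: the list
  \<open>E (Suc i)\<close> generates the syzygies of \<open>E i\<close> and has linear entries, so its vectors are the columns of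
  the matrix \<open>D i\<close>.
\<close>

theorem lin_quot_list_has_linear_resolution:
  fixes gs :: "'x::finite mon list"
  assumes lq: "lin_quot_list gs" and deg: "\<And>g. g \<in> set gs \<Longrightarrow> deg g = q"
  shows "has_linear_resolution (*) (\<lambda>d. {p. homogeneous d p})
    (monomial_ideal (set gs) :: ('x, 'k::field) mpoly set)"
proof -
  let ?e = "\<lambda>g i. if i = 0 then pmon g else 0 :: ('x, 'k) mpoly"
  let ?M = "monomial_ideal (set gs) :: ('x, 'k) mpoly set"
  let ?next = "\<lambda>es es'. vec_lin_quot (length es) 1 es' \<and> vec_span es' = syzygies es"
  have "\<exists>E. E 0 = map ?e gs \<and> (\<forall>i. (\<exists>r d. vec_lin_quot r d (E i)) \<and> ?next (E i) (E (Suc i)))"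
  proof -
    have "\<exists>E. \<forall>i. ((\<exists>r d. vec_lin_quot r d (E i)) \<and> (i = 0 \<longrightarrow> E i = map ?e gs)) \<and> ?next (E i) (E (Suc i))"
    proof (rule dependent_nat_choice)
      show "\<exists>es. (\<exists>r d. vec_lin_quot r d es) \<and> ((0::nat) = 0 \<longrightarrow> es = map ?e gs)"
        using vec_lin_quot_monomials[OF lq deg] by auto
    next
      fix es :: "(nat \<Rightarrow> ('x, 'k) mpoly) list" and n :: nat
      assume "(\<exists>r d. vec_lin_quot r d es) \<and> (n = 0 \<longrightarrow> es = map ?e gs)"
      then show "\<exists>es'. ((\<exists>r d. vec_lin_quot r d es') \<and> (Suc n = 0 \<longrightarrow> es' = map ?e gs)) \<and> ?next es es'"
        using syzygies_lin_quot by fastforce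
    qed
    then show ?thesis by blast
  qed
  then obtain E where E0: "E 0 = map ?e gs"
    and E: "\<And>i. vec_lin_quot (length (E i)) 1 (E (Suc i))" "\<And>i. vec_span (E (Suc i)) = syzygies (E i)"
    by blast
  define b where "b i = length (E i)" for i
  define D where "D i r c = (E (Suc i) ! c) r" for i r c
  let ?s = "\<lambda>i (j::nat). int q + int i" and ?g = "\<lambda>j. pmon (gs ! j) :: ('x, 'k) mpoly"
  have D: "homogeneous 1 (D i r c)" if "c < b (Suc i)" for i r c
    using vec_lin_quot_entries[OF E(1)[of i], of "E (Suc i) ! c"] that by (simp add: D_def b_def)
  have mat: "mat_apply (b i) (b (Suc i)) (D i) v = vec_comb (E (Suc i)) v" for i v
  proof
    fix k
    have "(E (Suc i) ! j) k = 0" if "b i \<le> k" "j < b (Suc i)" for j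
      using vec_lin_quot_entries[OF E(1)[of i], of "E (Suc i) ! j"] that
      by (simp add: b_def free_vecs_def)
    then show "mat_apply (b i) (b (Suc i)) (D i) v k = vec_comb (E (Suc i)) v k"
      by (auto simp: mat_apply_def vec_comb_def D_def b_def)
  qed
  have lin: "lin_comb (*) (b 0) ?g v = vec_comb (E 0) v 0" for v
    by (simp add: lin_comb_def vec_comb_def E0 b_def mult.commute)
  have E0_zero: "vec_comb (E 0) v i = 0" if "i > 0" for v i
    using that by (simp add: vec_comb_def E0)
  have image: "mat_apply (b i) (b (Suc i)) (D i) ` free_vecs (b (Suc i)) = syzygies (E i)" for i
    using E(2)[of i] by (simp add: mat vec_comb_free_vecs flip: b_def)
  have "graded_free_resolution (*) (\<lambda>d. {p. homogeneous d p}) ?M b ?s ?g D"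
    unfolding graded_free_resolution_def
  proof (intro conjI allI impI)
    fix j assume "j < b 0"
    then show "?g j \<in> ?M \<inter> {p. homogeneous (?s 0 j) p}"
      using deg by (auto simp: b_def E0 intro: mon_dvd_refl)
  next
    fix i r c assume "c < b (Suc i)"
    then show "homogeneous (?s (Suc i) c - ?s i r) (D i r c)" using D by simp
  next
    have "p \<in> lin_comb (*) (b 0) ?g ` free_vecs (b 0) \<longleftrightarrow> p \<in> ?M" for p
    proof -
      have "p \<in> ?M \<longleftrightarrow> (\<lambda>i. if i = 0 then p else 0) \<in> vec_comb (E 0) ` free_vecs (b 0)"
        unfolding b_def vec_comb_free_vecs[symmetric] E0 vec_span_monomials by simp
      also have "\<dots> \<longleftrightarrow> (\<exists>v\<in>free_vecs (b 0). p = vec_comb (E 0) v 0)"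
      proof -
        have "(\<lambda>i. if i = 0 then p else 0) = vec_comb (E 0) v \<longleftrightarrow> p = vec_comb (E 0) v 0" for v
          using E0_zero[of _ v] by (auto simp: fun_eq_iff)
        then show ?thesis by (simp only: image_iff)
      qed
      finally show ?thesis by (auto simp: lin)
    qed
    then show "lin_comb (*) (b 0) ?g ` free_vecs (b 0) = ?M" by blast
  next
    have "vec_comb (E 0) v 0 = 0 \<longleftrightarrow> vec_comb (E 0) v = (\<lambda>_. 0)" for v
      using E0_zero by (metis neq0_conv)
    then show "{v \<in> free_vecs (b 0). lin_comb (*) (b 0) ?g v = 0} =
        mat_apply (b 0) (b 1) (D 0) ` free_vecs (b 1)"
      unfolding lin using image[of 0] by (simp add: syzygies_def b_def)
  next
    fix i
    show "{v \<in> free_vecs (b (Suc i)). mat_apply (b i) (b (Suc i)) (D i) v = (\<lambda>_. 0)} =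
        mat_apply (b (Suc i)) (b (Suc (Suc i))) (D (Suc i)) ` free_vecs (b (Suc (Suc i)))"
      unfolding image mat by (simp add: syzygies_def b_def)
  qed
  moreover have "Poly_Mapping.lookup (D i r c) 0 = 0" if "c < b (Suc i)" for i r c
    using D[OF that, of r] by (auto simp: homogeneous_lookup)
  ultimately show ?thesis
    unfolding has_linear_resolution_def minimal_graded_free_resolution_def
    by (intro exI[of _ "int q"] exI[of _ b] exI[of _ ?s] exI[of _ ?g] exI[of _ D]) auto
qed

section \<open>Ordered sets of monomials with linear quotients\<close>

definition strict_total_on :: "'a set \<Rightarrow> ('a \<Rightarrow> 'a \<Rightarrow> bool) \<Rightarrow> bool" where
  "strict_total_on A R \<longleftrightarrow> irreflp_on A R \<and> transp_on A R \<and> totalp_on A R"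

lemma strict_total_on_subset: "strict_total_on A R \<Longrightarrow> B \<subseteq> A \<Longrightarrow> strict_total_on B R"
  unfolding strict_total_on_def
  by (meson irreflp_on_subset transp_on_subset totalp_on_subset)

lemma strict_total_on_least:
  assumes "finite A" "A \<noteq> {}" "strict_total_on A R"
  obtains a where "a \<in> A" "\<forall>b\<in>A. a = b \<or> R a b"
proof -
  have "\<exists>a\<in>A. \<forall>b\<in>A. a = b \<or> R a b"
    using assms
  proof (induction A rule: finite_ne_induct)
    case (insert x F)
    then have "strict_total_on F R" by (meson strict_total_on_subset subset_insertI)
    with insert.IH obtain a where a: "a \<in> F" "\<forall>b\<in>F. a = b \<or> R a b" by auto
    have "x \<noteq> a" using a insert.hyps by auto
    then have "R x a \<or> R a x"
      using insert.prems a unfolding strict_total_on_def totalp_on_def by (meson insertCI)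
    then show ?case
    proof
      assume "R x a"
      then have "R x b" if "b \<in> F" for b
        using that insert.prems a unfolding strict_total_on_def transp_on_def by (metis insertCI)
      then show ?thesis by auto
    next
      assume "R a x"
      then show ?thesis using a by auto
    qed
  qed auto
  then show ?thesis using that by blast
qed

lemma strict_total_on_sorted_list:
  assumes "finite A" "strict_total_on A R"
  obtains xs where "distinct xs" "set xs = A" "sorted_wrt R xs"
proof -
  have "\<exists>xs. distinct xs \<and> set xs = A \<and> sorted_wrt R xs"
    using assms
  proof (induction "card A" arbitrary: A)
    case 0
    then show ?case by auto
  next
    case (Suc n)
    then obtain a where a: "a \<in> A" "\<forall>b\<in>A. a = b \<or> R a b"
      by (metis strict_total_on_least card.empty nat.distinct(1))
    have "n = card (A - {a})" using Suc a by simp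
    moreover have "strict_total_on (A - {a}) R" using Suc.prems by (meson strict_total_on_subset Diff_subset)
    ultimately obtain xs where "distinct xs" "set xs = A - {a}" "sorted_wrt R xs"
      using Suc.hyps(1)[of "A - {a}"] Suc.prems by auto
    then show ?case using a by (intro exI[of _ "a # xs"]) auto
  qed
  then show ?thesis using that by blast
qed

text \<open>
  The condition of \<open>lin_quot_list\<close> for a set whose elements are enumerated along \<open>R\<close>.
\<close>

definition lin_quot_order :: "'x mon set \<Rightarrow> ('x mon \<Rightarrow> 'x mon \<Rightarrow> bool) \<Rightarrow> bool" where
  "lin_quot_order A R \<longleftrightarrow> strict_total_on A R \<and>
     (\<forall>u\<in>A. \<forall>v\<in>A. R u v \<longrightarrow> (\<exists>x. Poly_Mapping.lookup v x < Poly_Mapping.lookup u x \<and>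
        (\<exists>u'\<in>A. R u' v \<and> u' \<preceq> v + Poly_Mapping.single x 1)))"

lemma lin_quot_order_list:
  assumes "finite A" "lin_quot_order A R"
  obtains gs where "distinct gs" "set gs = A" "lin_quot_list gs"
proof -
  from assms have st: "strict_total_on A R" by (simp add: lin_quot_order_def)
  from strict_total_on_sorted_list[OF assms(1) st]
  obtain gs where gs: "distinct gs" "set gs = A" "sorted_wrt R gs" .
  have "lin_quot_list gs"
    unfolding lin_quot_list_def
  proof (intro allI impI)
    fix i j assume ij: "j < length gs" "i < j"
    then have in_A: "gs ! i \<in> A" "gs ! j \<in> A" using gs by auto
    moreover have "R (gs ! i) (gs ! j)" using gs(3) ij by (simp add: sorted_wrt_iff_nth_less)
    ultimately obtain x u where x: "Poly_Mapping.lookup (gs ! j) x < Poly_Mapping.lookup (gs ! i) x"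
      and u: "u \<in> A" "R u (gs ! j)" "u \<preceq> gs ! j + Poly_Mapping.single x 1"
      using assms(2) unfolding lin_quot_order_def by blast
    from u(1) obtain i' where i': "i' < length gs" "u = gs ! i'" using gs(2) by (metis in_set_conv_nth)
    have "i' < j"
    proof (rule ccontr)
      assume "\<not> i' < j"
      then have "u = gs ! j \<or> R (gs ! j) u"
        using gs(3) i' by (metis linorder_neqE_nat sorted_wrt_iff_nth_less)
      then show False
        using u(1,2) in_A st unfolding strict_total_on_def irreflp_on_def transp_on_def by blast
    qed
    then show "\<exists>x. Poly_Mapping.lookup (gs ! j) x < Poly_Mapping.lookup (gs ! i) x \<and>
        (\<exists>i'<j. gs ! i' \<preceq> gs ! j + Poly_Mapping.single x 1)"
      using x u(3) i' by blast
  qed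
  then show ?thesis using gs that by blast
qed

definition mon_antichain :: "'x mon set \<Rightarrow> bool" where
  "mon_antichain A \<longleftrightarrow> (\<forall>u\<in>A. \<forall>v\<in>A. u \<preceq> v \<longrightarrow> u = v)"

theorem lin_quot_order_linear_quotients:
  assumes "finite A" "lin_quot_order A R" "mon_antichain A"
  shows "linear_quotients (monomial_ideal A :: ('x, 'k::field) mpoly set)"
proof -
  from lin_quot_order_list[OF assms(1,2)]
  obtain gs where gs: "distinct gs" "set gs = A" "lin_quot_list gs" .
  have "\<exists>L :: ('x, 'k) mpoly set. (\<forall>l\<in>L. homogeneous 1 l) \<and>
      colon (ideal_span (pmon ` set (take j gs))) (pmon (gs ! j)) = ideal_span L"
    if "j < length gs" for j
  proof -
    let ?X = "{x. \<exists>i<j. gs ! i \<preceq> gs ! j + Poly_Mapping.single x 1}"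
    have "colon (ideal_span (pmon ` set (take j gs))) (pmon (gs ! j)) = (var_ideal ?X :: ('x, 'k) mpoly set)"
      using colon_eq_var_ideal[OF gs(3) that] by (auto simp: colon_def ideal_span_pmon)
    then show ?thesis
      by (intro exI[of _ "pmon ` (\<lambda>x. Poly_Mapping.single x 1) ` ?X"]) (auto simp: var_ideal_span)
  qed
  moreover have "minimal_monomial_generators (set gs) (monomial_ideal A :: ('x, 'k) mpoly set)"
    using assms(3) gs by (simp add: minimal_monomial_generators_iff mon_antichain_def)
  ultimately show ?thesis using gs(1) unfolding linear_quotients_def by blast
qed

section \<open>The degree components of an ideal with linear quotients\<close>

text \<open>
  The lexicographic order in which larger monomials come first, with the variables ranked by \<open>c\<close>.
\<close>

definition lex_before :: "('x \<Rightarrow> nat) \<Rightarrow> 'x mon \<Rightarrow> 'x mon \<Rightarrow> bool" where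
  "lex_before c u v \<longleftrightarrow> (\<exists>x. Poly_Mapping.lookup v x < Poly_Mapping.lookup u x \<and>
     (\<forall>y. c y < c x \<longrightarrow> Poly_Mapping.lookup u y = Poly_Mapping.lookup v y))"

lemma strict_total_lex_before:
  assumes "inj c"
  shows "strict_total_on A (lex_before c)"
  unfolding strict_total_on_def
proof (intro conjI)
  show "irreflp_on A (lex_before c)" by (auto simp: irreflp_on_def lex_before_def)
  show "transp_on A (lex_before c)"
  proof (rule transp_onI)
    fix u v w assume "lex_before c u v" "lex_before c v w"
    then obtain x y where
      x: "Poly_Mapping.lookup v x < Poly_Mapping.lookup u x"
         "\<And>z. c z < c x \<Longrightarrow> Poly_Mapping.lookup u z = Poly_Mapping.lookup v z" and
      y: "Poly_Mapping.lookup w y < Poly_Mapping.lookup v y"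
         "\<And>z. c z < c y \<Longrightarrow> Poly_Mapping.lookup v z = Poly_Mapping.lookup w z"
      unfolding lex_before_def by blast
    consider "c x < c y" | "x = y" | "c y < c x"
      using assms by (metis linorder_neqE_nat injD)
    then show "lex_before c u w"
    proof cases
      case 1
      then show ?thesis using x y by (auto simp: lex_before_def intro!: exI[of _ x])
    next
      case 2
      then show ?thesis using x y by (auto simp: lex_before_def intro!: exI[of _ x])
    next
      case 3
      then show ?thesis using x y by (auto simp: lex_before_def intro!: exI[of _ y])
    qed
  qed
  show "totalp_on A (lex_before c)"
  proof (rule totalp_onI)
    fix u v :: "'a mon" assume "u \<noteq> v"
    then have "\<exists>x. Poly_Mapping.lookup u x \<noteq> Poly_Mapping.lookup v x" by (metis poly_mapping_eqI)
    then obtain x where x: "Poly_Mapping.lookup u x \<noteq> Poly_Mapping.lookup v x"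
      and "\<And>y. c y < c x \<Longrightarrow> Poly_Mapping.lookup u y = Poly_Mapping.lookup v y"
      using exists_least_iff[of "\<lambda>n. \<exists>x. c x = n \<and> Poly_Mapping.lookup u x \<noteq> Poly_Mapping.lookup v x"]
      by metis
    then show "lex_before c u v \<or> lex_before c v u"
      by (metis lex_before_def linorder_neqE_nat)
  qed
qed

lemma deg_less_imp_lookup_less:
  assumes "deg u \<le> deg v" "Poly_Mapping.lookup v x < Poly_Mapping.lookup u x"
  obtains y where "Poly_Mapping.lookup u y < Poly_Mapping.lookup v y"
proof -
  have "\<not> v \<preceq> u" using mon_dvd_deg_eq[of v u] assms by auto
  then show ?thesis using that by (auto simp: mon_dvd_def not_le)
qed

definition deg_part :: "nat \<Rightarrow> 'x mon set \<Rightarrow> 'x mon set" where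
  "deg_part q A = {u. deg u = q \<and> (\<exists>g\<in>A. g \<preceq> u)}"

lemma finite_deg_part: "finite (deg_part q (A :: 'x::finite mon set))"
  by (rule finite_subset[OF _ finite_mons_of_deg[of UNIV q]]) (auto simp: deg_part_def)

text \<open>
  Let \<open>m u\<close> be the \<open>R\<close>-first element of \<open>A\<close> that divides \<open>u\<close>. The monomials of degree \<open>q\<close> are ordered by
  \<open>m u\<close> and, for equal \<open>m u\<close>, lexicographically.

  If \<open>m u\<close> precedes \<open>m v\<close>, then some variable \<open>x\<close> that occurs to a higher power in \<open>m u\<close> than in \<open>m v\<close>
  satisfies \<open>a | x \<cdot> m v\<close> for an \<open>a \<in> A\<close> before \<open>m v\<close>. It does not divide \<open>v / m v\<close>, since otherwise
  \<open>a\<close> would divide \<open>v\<close>, so it also occurs to a higher power in \<open>u\<close> than in \<open>v\<close>. Cancelling a variable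
  from \<open>x v / a\<close> gives the desired monomial; there is one to cancel since otherwise \<open>m v\<close> would divide
  \<open>a\<close>.

  If \<open>m u = m v\<close>, exchange a variable \<open>h\<close> of \<open>v / m v\<close> for the first variable \<open>x\<close> in which \<open>u\<close> and \<open>v\<close>
  differ.
\<close>

lemma deg_part_lin_quot_order:
  fixes A :: "'x::finite mon set"
  assumes "finite A" and lq: "lin_quot_order A R" and anti: "mon_antichain A"
  shows "\<exists>R'. lin_quot_order (deg_part q A) R'"
proof -
  from lq have st: "strict_total_on A R" by (simp add: lin_quot_order_def)
  then have trans: "R a c" if "R a b" "R b c" "a \<in> A" "b \<in> A" "c \<in> A" for a b c
    using that unfolding strict_total_on_def transp_on_def by blast
  from st have irrefl: "\<not> R a a" if "a \<in> A" for a
    using that unfolding strict_total_on_def irreflp_on_def by blast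
  obtain enc :: "'x \<Rightarrow> nat" where enc: "inj enc"
    using finite_imp_inj_to_nat_seg[of "UNIV :: 'x set"] by auto
  have ex: "\<exists>a. a \<in> A \<and> a \<preceq> u \<and> (\<forall>b\<in>A. b \<preceq> u \<longrightarrow> a = b \<or> R a b)" if "u \<in> deg_part q A" for u
  proof -
    let ?D = "{a \<in> A. a \<preceq> u}"
    have "finite ?D" "?D \<noteq> {}" "strict_total_on ?D R"
      using that assms(1) strict_total_on_subset[OF st, of ?D] by (auto simp: deg_part_def)
    then obtain a where "a \<in> ?D" "\<forall>b\<in>?D. a = b \<or> R a b"
      by (rule strict_total_on_least)
    then show ?thesis by blast
  qed
  define m where "m u = (SOME a. a \<in> A \<and> a \<preceq> u \<and> (\<forall>b\<in>A. b \<preceq> u \<longrightarrow> a = b \<or> R a b))" for u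
  have m: "m u \<in> A" "m u \<preceq> u" and m_least: "b \<in> A \<Longrightarrow> b \<preceq> u \<Longrightarrow> m u = b \<or> R (m u) b"
    if "u \<in> deg_part q A" for u b
    using someI_ex[OF ex[OF that]] unfolding m_def by blast+
  define R' where "R' u v \<longleftrightarrow> R (m u) (m v) \<or> m u = m v \<and> lex_before enc u v" for u v
  have lex: "strict_total_on (deg_part q A) (lex_before enc)"
    by (rule strict_total_lex_before[OF enc])
  have "strict_total_on (deg_part q A) R'"
    unfolding strict_total_on_def
  proof (intro conjI)
    show "irreflp_on (deg_part q A) R'"
      using irrefl m lex by (auto simp: irreflp_on_def R'_def strict_total_on_def)
    show "transp_on (deg_part q A) R'"
    proof (rule transp_onI)
      fix u v w assume *: "u \<in> deg_part q A" "v \<in> deg_part q A" "w \<in> deg_part q A" "R' u v" "R' v w"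
      have "lex_before enc u w" if "lex_before enc u v" "lex_before enc v w"
        using lex that * unfolding strict_total_on_def transp_on_def by blast
      then show "R' u w" using * trans[of "m u" "m v" "m w"] m unfolding R'_def by auto
    qed
    show "totalp_on (deg_part q A) R'"
    proof (rule totalp_onI)
      fix u v assume *: "u \<in> deg_part q A" "v \<in> deg_part q A" "u \<noteq> v"
      then have "lex_before enc u v \<or> lex_before enc v u"
        using lex unfolding strict_total_on_def totalp_on_def by blast
      moreover have "m u = m v \<or> R (m u) (m v) \<or> R (m v) (m u)"
        using st m * unfolding strict_total_on_def totalp_on_def by blast
      ultimately show "R' u v \<or> R' v u" by (auto simp: R'_def)
    qed
  qed
  moreover have "\<exists>x. Poly_Mapping.lookup v x < Poly_Mapping.lookup u x \<and>
      (\<exists>u'\<in>deg_part q A. R' u' v \<and> u' \<preceq> v + Poly_Mapping.single x 1)"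
    if u: "u \<in> deg_part q A" and v: "v \<in> deg_part q A" and less: "R' u v" for u v
    using less[unfolded R'_def]
  proof
    assume "R (m u) (m v)"
    then obtain x a where x: "Poly_Mapping.lookup (m v) x < Poly_Mapping.lookup (m u) x"
      and a: "a \<in> A" "R a (m v)" "a \<preceq> m v + Poly_Mapping.single x 1"
      using lq m u v unfolding lin_quot_order_def by blast
    from m(2)[OF v] obtain s where s: "v = m v + s" by (rule mon_dvdE)
    have "Poly_Mapping.lookup s x = 0"
    proof (rule ccontr)
      assume "Poly_Mapping.lookup s x \<noteq> 0"
      then have "m v + Poly_Mapping.single x 1 \<preceq> v"
        by (subst s) (auto simp: mon_dvd_def lookup_add lookup_single when_def)
      then have "a \<preceq> v" using a(3) mon_dvd_trans by blast
      then have "m v = a \<or> R (m v) a" using m_least[OF v] a by blast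
      then show False using a irrefl trans[of a "m v" a] m(1)[OF v] by auto
    qed
    then have "Poly_Mapping.lookup v x = Poly_Mapping.lookup (m v) x" by (subst s) (simp add: lookup_add)
    also note x
    also have "Poly_Mapping.lookup (m u) x \<le> Poly_Mapping.lookup u x"
      using m(2)[OF u] by (simp add: mon_dvd_def)
    finally have "Poly_Mapping.lookup v x < Poly_Mapping.lookup u x" .
    moreover have "\<exists>u'\<in>deg_part q A. R' u' v \<and> u' \<preceq> v + Poly_Mapping.single x 1"
    proof -
      have "m v + Poly_Mapping.single x 1 \<preceq> v + Poly_Mapping.single x 1" using m(2)[OF v] by simp
      then have "a \<preceq> v + Poly_Mapping.single x 1" using a(3) mon_dvd_trans by blast
      then obtain z where z: "v + Poly_Mapping.single x 1 = a + z" by (rule mon_dvdE)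
      have "z \<noteq> 0"
      proof
        assume "z = 0"
        then have "m v \<preceq> a" using z m(2)[OF v] mon_dvd_trans[OF _ mon_dvd_add(1)] by (metis add.right_neutral)
        then show False using anti m(1)[OF v] a irrefl unfolding mon_antichain_def by blast
      qed
      then obtain h where "Poly_Mapping.lookup z h \<noteq> 0" by (rule nonzero_monE)
      then have "Poly_Mapping.single h 1 \<preceq> z" by (simp only: single_mon_dvd_iff not_False_eq_True)
      then obtain z' where z': "z = Poly_Mapping.single h 1 + z'" by (rule mon_dvdE)
      let ?u = "a + z'"
      have "deg (v + Poly_Mapping.single x 1) = deg (a + (Poly_Mapping.single h 1 + z'))"
        by (simp only: z z')
      then have "?u \<in> deg_part q A"
        using v a(1) by (auto simp: deg_part_def intro!: bexI[of _ a])
      moreover from this have "m ?u = a \<or> R (m ?u) a" using a(1) by (intro m_least) auto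
      then have "R' ?u v"
        using a trans[of "m ?u" a "m v"] m(1)[OF v] m(1)[OF calculation] by (auto simp: R'_def)
      moreover have "?u \<preceq> v + Poly_Mapping.single x 1"
        using mon_dvd_add(2)[of ?u "Poly_Mapping.single h 1"] z z' by (simp only: ac_simps)
      ultimately show ?thesis by blast
    qed
    ultimately show ?thesis by blast
  next
    assume eq: "m u = m v \<and> lex_before enc u v"
    then obtain x where x: "Poly_Mapping.lookup v x < Poly_Mapping.lookup u x"
      and before: "\<And>y. enc y < enc x \<Longrightarrow> Poly_Mapping.lookup u y = Poly_Mapping.lookup v y"
      unfolding lex_before_def by blast
    have "deg u \<le> deg v" using u v by (simp add: deg_part_def)
    then obtain h where h: "Poly_Mapping.lookup u h < Poly_Mapping.lookup v h"
      using x by (rule deg_less_imp_lookup_less)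
    then have "Poly_Mapping.single h 1 \<preceq> v" unfolding single_mon_dvd_iff by simp
    then obtain w where w: "v = Poly_Mapping.single h 1 + w" by (rule mon_dvdE)
    let ?u = "w + Poly_Mapping.single x 1"
    have "m v \<preceq> w"
      unfolding mon_dvd_def
    proof
      fix y
      have "Poly_Mapping.lookup (m v) h \<le> Poly_Mapping.lookup u h"
        using m(2)[OF u] eq by (simp add: mon_dvd_def)
      moreover have "Poly_Mapping.lookup v h = Suc (Poly_Mapping.lookup w h)"
        by (subst w) (simp add: lookup_add)
      moreover have "Poly_Mapping.lookup v y = Poly_Mapping.lookup w y" if "y \<noteq> h"
        using that by (subst w) (simp add: lookup_add lookup_single)
      moreover have "Poly_Mapping.lookup (m v) y \<le> Poly_Mapping.lookup v y"
        using m(2)[OF v] by (simp add: mon_dvd_def)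
      ultimately show "Poly_Mapping.lookup (m v) y \<le> Poly_Mapping.lookup w y"
        using h by (cases "y = h") auto
    qed
    then have mv: "m v \<preceq> ?u" using mon_dvd_trans mon_dvd_add(1) by blast
    have "x \<noteq> h" using x h by auto
    have "deg v = deg ?u" by (subst w) simp
    then have in_part: "?u \<in> deg_part q A" using v m(1)[OF v] mv by (auto simp: deg_part_def)
    have "lex_before enc ?u v"
      unfolding lex_before_def
    proof (intro exI[of _ x] conjI allI impI)
      show "Poly_Mapping.lookup v x < Poly_Mapping.lookup ?u x"
        by (subst w) (use \<open>x \<noteq> h\<close> in \<open>simp add: lookup_add lookup_single\<close>)
      fix y assume "enc y < enc x"
      then have "y \<noteq> x" "y \<noteq> h" using before h by auto
      then show "Poly_Mapping.lookup ?u y = Poly_Mapping.lookup v y"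
        by (subst w) (simp add: lookup_add lookup_single)
    qed
    then have "R' ?u v" using m_least[OF in_part m(1)[OF v] mv] by (auto simp: R'_def)
    moreover have "?u \<preceq> v + Poly_Mapping.single x 1"
      by (subst w) (simp add: mon_dvd_def lookup_add)
    ultimately show ?thesis using x in_part by blast
  qed
  ultimately have "lin_quot_order (deg_part q A) R'" by (auto simp: lin_quot_order_def)
  then show ?thesis by blast
qed

lemma ideal_span_deg_part:
  fixes A :: "'x mon set"
  shows "ideal_span (monomial_ideal A \<inter> {p. homogeneous (int q) p}) =
    (monomial_ideal (deg_part q A) :: ('x, 'k::field) mpoly set)" (is "ideal_span ?C = ?M")
proof (rule module.span_subspace[OF module_mult _ _ subspace_monomial_ideal])
  show "?C \<subseteq> ?M"
    by (auto simp: monomial_ideal_def deg_part_def homogeneous_def)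
  have "pmon ` deg_part q A \<subseteq> ?C" by (auto simp: deg_part_def)
  then show "?M \<subseteq> ideal_span ?C"
    by (simp add: module.span_mono[OF module_mult] flip: ideal_span_pmon)
qed

text \<open>
  A monomial ideal contains all terms of its elements, hence their homogeneous components.
\<close>

lemma graded_module_monomial_ideal:
  "graded_module (*) (\<lambda>d. {p. homogeneous d p}) (monomial_ideal A :: ('x, 'k::field) mpoly set)"
  (is "graded_module _ ?G ?M")
  unfolding graded_module_def
proof (intro conjI allI impI ballI)
  show "0 \<in> ?M \<inter> ?G d" for d by (simp add: monomial_ideal_def)
  show "p - q \<in> ?G d" if "p \<in> ?M \<inter> ?G d" "q \<in> ?M \<inter> ?G d" for d p q
    using that by (simp add: homogeneous_diff)
  show "p * q \<in> ?G (e + d)" if "homogeneous e p" "q \<in> ?M \<inter> ?G d" for e d p q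
    using that by (simp add: homogeneous_mult)
  fix p assume p: "p \<in> ?M"
  let ?decomp = "\<lambda>c. finite {d. c d \<noteq> 0} \<and> (\<forall>d. c d \<in> ?M \<inter> ?G d) \<and> p = (\<Sum>d | c d \<noteq> 0. c d)"
  have "?decomp (\<lambda>d. hom_comp d p)"
  proof (intro conjI allI)
    have "hom_comp d p = 0" if "d \<notin> (\<lambda>u. int (deg u)) ` Poly_Mapping.keys p" for d
      using that by (intro poly_mapping_eqI) (auto simp: lookup_hom_comp in_keys_iff)
    then have sub: "{d. hom_comp d p \<noteq> 0} \<subseteq> (\<lambda>u. int (deg u)) ` Poly_Mapping.keys p" by auto
    then show fin: "finite {d. hom_comp d p \<noteq> 0}" by (rule finite_subset) simp
    show "hom_comp d p \<in> ?M \<inter> ?G d" for d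
      using p by (auto simp: monomial_ideal_def homogeneous_hom_comp in_keys_iff lookup_hom_comp
          split: if_splits)
    show "p = (\<Sum>d | hom_comp d p \<noteq> 0. hom_comp d p)"
    proof (rule poly_mapping_eqI)
      fix u
      have "Poly_Mapping.lookup p u = 0" if "hom_comp (int (deg u)) p = 0"
        using lookup_hom_comp[of "int (deg u)" p u] that by simp
      then show "Poly_Mapping.lookup p u = Poly_Mapping.lookup (\<Sum>d | hom_comp d p \<noteq> 0. hom_comp d p) u"
        using fin by (auto simp: lookup_sum lookup_hom_comp)
    qed
  qed
  moreover have "c = (\<lambda>d. hom_comp d p)" if c: "?decomp c" for c
  proof
    fix d
    have "hom_comp d p = (\<Sum>e | c e \<noteq> 0. hom_comp d (c e))" using c by (metis hom_comp_sum)
    also have "\<dots> = (\<Sum>e | c e \<noteq> 0. if d = e then c e else 0)"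
      using c by (intro sum.cong refl hom_comp_homogeneous) auto
    also have "\<dots> = c d" using c by auto
    finally show "c d = hom_comp d p" by simp
  qed
  ultimately show "\<exists>!c. ?decomp c" by (rule ex1I)
qed (use module_mult subspace_monomial_ideal in auto)

text \<open>The components of negative degree are zero and are resolved by the empty list.\<close>

theorem lin_quot_order_componentwise_linear:
  fixes A :: "'x::finite mon set"
  assumes "finite A" "lin_quot_order A R" "mon_antichain A"
  shows "componentwise_linear (*) (\<lambda>d. {p. homogeneous d p})
    (monomial_ideal A :: ('x, 'k::field) mpoly set)"
  unfolding componentwise_linear_def
proof (intro conjI allI graded_module_monomial_ideal)
  let ?C = "\<lambda>k. monomial_ideal A \<inter> {p :: ('x, 'k) mpoly. homogeneous k p}"
  fix k :: int
  have "\<exists>gs q. ideal_span (?C k) = monomial_ideal (set gs) \<and> lin_quot_list gs \<and> (\<forall>g\<in>set gs. deg g = q)"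
  proof (cases "k \<ge> 0")
    case True
    then obtain q where q: "k = int q" by (metis nonneg_int_cases)
    obtain R' where "lin_quot_order (deg_part q A) R'" using deg_part_lin_quot_order[OF assms] by blast
    then obtain gs where "set gs = deg_part q A" "lin_quot_list gs"
      using lin_quot_order_list finite_deg_part by metis
    then show ?thesis
      by (intro exI[of _ gs] exI[of _ q]) (auto simp: q ideal_span_deg_part, simp add: deg_part_def)
  next
    case False
    then have "Poly_Mapping.keys p = {}" if "homogeneous k p" for p :: "('x, 'k) mpoly"
      using that by (force simp: homogeneous_def)
    then have "?C k = {0}" by (auto simp: monomial_ideal_def)
    moreover have "ideal_span {0 :: ('x, 'k) mpoly} = monomial_ideal {}"
      using module.span_zero[OF module_mult] module.span_singleton[OF module_mult, of 0]
      by (auto simp: monomial_ideal_def)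
    ultimately show ?thesis by (intro exI[of _ "[]"]) (simp add: lin_quot_list_def)
  qed
  then show "has_linear_resolution (*) (\<lambda>d. {p. homogeneous d p}) (ideal_span (?C k))"
    using lin_quot_list_has_linear_resolution by metis
qed

section \<open>Products of the generators\<close>

definition gen_prod :: "nat \<Rightarrow> (nat \<Rightarrow> 'x mon) \<Rightarrow> nat mon \<Rightarrow> 'x mon" where
  "gen_prod m f w = (\<Sum>j<m. \<Sum>_<Poly_Mapping.lookup w j. f j)"

lemma lookup_gen_prod:
  "Poly_Mapping.lookup (gen_prod m f w) x =
    (\<Sum>j<m. Poly_Mapping.lookup w j * Poly_Mapping.lookup (f j) x)"
  by (simp add: gen_prod_def lookup_sum)

lemma gen_prod_add: "gen_prod m f (v + w) = gen_prod m f v + gen_prod m f w"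
  by (rule poly_mapping_eqI) (simp add: lookup_gen_prod lookup_add sum.distrib distrib_right)

lemma gen_prod_zero [simp]: "gen_prod m f 0 = 0"
  by (simp add: gen_prod_def)

lemma gen_prod_single: 
  assumes "i < m"
  shows "gen_prod m f (Poly_Mapping.single i 1) = f i"
proof (rule poly_mapping_eqI)
  fix x
  have "(\<Sum>j<m. Poly_Mapping.lookup (Poly_Mapping.single i 1) j * Poly_Mapping.lookup (f j) x) =
      (\<Sum>j<m. if j = i then Poly_Mapping.lookup (f i) x else 0)"
    by (intro sum.cong) (auto simp: lookup_single)
  then show "Poly_Mapping.lookup (gen_prod m f (Poly_Mapping.single i 1)) x = Poly_Mapping.lookup (f i) x"
    using assms by (simp add: lookup_gen_prod)
qed

lemma mons_in_add [simp]: "v + w \<in> mons_in V \<longleftrightarrow> v \<in> mons_in V \<and> w \<in> mons_in (V :: 'v set)"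
  by (auto simp: mons_in_def keys_add_mon)

lemma zero_in_mons_in [simp]: "0 \<in> mons_in V"
  by (simp add: mons_in_def)

lemma single_in_mons_in [simp]: "Poly_Mapping.single v (1 :: nat) \<in> mons_in V \<longleftrightarrow> v \<in> V"
  by (simp add: mons_in_def)

lemma mons_in_mon_dvd: "v \<preceq> w \<Longrightarrow> w \<in> mons_in V \<Longrightarrow> v \<in> mons_in V"
  by (auto elim!: mon_dvdE)

lemma ideal_prod_monomial:
  "ideal_prod (monomial_ideal A) (monomial_ideal B) =
    (monomial_ideal {a + b | a b. a \<in> A \<and> b \<in> B} :: ('x, 'k::field) mpoly set)"
  (is "_ = ?M")
  unfolding ideal_prod_def
proof (rule module.span_subspace[OF module_mult _ _ subspace_monomial_ideal])
  let ?P = "{p * q | p q. p \<in> monomial_ideal A \<and> q \<in> monomial_ideal B} :: ('x, 'k) mpoly set"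
  have "p * q \<in> ?M" if pq: "p \<in> monomial_ideal A" "q \<in> monomial_ideal B" for p q
    unfolding monomial_ideal_def
  proof (intro CollectI ballI)
    fix u assume "u \<in> Poly_Mapping.keys (p * q)"
    then obtain v w where vw: "v \<in> Poly_Mapping.keys p" "w \<in> Poly_Mapping.keys q" "u = v + w"
      using keys_mult[of p q] by auto
    then obtain a b where ab: "a \<in> A" "b \<in> B" "a \<preceq> v" "b \<preceq> w"
      using pq unfolding monomial_ideal_def by blast
    then have "a + b \<preceq> u" using vw by (simp add: mon_dvd_def lookup_add add_mono)
    then show "\<exists>g\<in>{a + b | a b. a \<in> A \<and> b \<in> B}. g \<preceq> u" using ab by blast
  qed
  then show "?P \<subseteq> ?M" by blast
  have "pmon ` {a + b | a b. a \<in> A \<and> b \<in> B} \<subseteq> ?P"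
    using mon_dvd_refl by (force simp: pmon_add)
  then show "?M \<subseteq> ideal_span ?P"
    by (simp only: module.span_mono[OF module_mult] flip: ideal_span_pmon)
qed

lemma ideal_power_monomial:
  "ideal_power (monomial_ideal (f ` {..<m})) k =
    (monomial_ideal (gen_prod m f ` {w \<in> mons_in {..<m}. deg w = k}) :: ('x, 'k::field) mpoly set)"
proof (induction k)
  case 0
  have "{w \<in> mons_in {..<m}. deg w = 0} = {0}" by auto
  then show ?case by (simp add: monomial_ideal_def)
next
  case (Suc k)
  have "{a + b | a b. a \<in> f ` {..<m} \<and> b \<in> gen_prod m f ` {w \<in> mons_in {..<m}. deg w = k}} =
      gen_prod m f ` {w \<in> mons_in {..<m}. deg w = Suc k}" (is "?L = ?R")
  proof (intro subset_antisym subsetI)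
    fix u assume "u \<in> ?L"
    then obtain i w where "i < m" "w \<in> mons_in {..<m}" "deg w = k" "u = f i + gen_prod m f w" by auto
    then show "u \<in> ?R"
      by (intro image_eqI[of _ _ "Poly_Mapping.single i 1 + w"])
        (auto simp: gen_prod_add gen_prod_single simp del: One_nat_def)
  next
    fix u assume "u \<in> ?R"
    then obtain w where w: "w \<in> mons_in {..<m}" "deg w = Suc k" "u = gen_prod m f w" by auto
    then have "w \<noteq> 0" by auto
    then obtain i where "Poly_Mapping.lookup w i \<noteq> 0" by (rule nonzero_monE)
    then have "Poly_Mapping.single i 1 \<preceq> w" by (simp only: single_mon_dvd_iff not_False_eq_True)
    then obtain v where v: "w = Poly_Mapping.single i 1 + v" by (rule mon_dvdE)
    have "i < m" "v \<in> mons_in {..<m}" using w(1) unfolding v by (auto simp del: One_nat_def)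
    moreover have "deg v = k" using w(2) unfolding v by simp
    moreover have "u = f i + gen_prod m f v"
      using w(3) \<open>i < m\<close> unfolding v by (simp add: gen_prod_add gen_prod_single del: One_nat_def)
    ultimately show "u \<in> ?L" by blast
  qed
  then show ?case by (simp only: ideal_power.simps Suc ideal_prod_monomial)
qed

section \<open>Standard monomials\<close>

locale ordered_generators =
  fixes m :: nat and f :: "nat \<Rightarrow> 'x::finite mon" and lty :: "nat mon \<Rightarrow> nat mon \<Rightarrow> bool"
  assumes lty: "monomial_order {..<m} lty"
begin

abbreviation Y :: "nat mon set" where
  "Y \<equiv> mons_in {..<m}"

abbreviation F :: "nat mon \<Rightarrow> 'x mon" where
  "F \<equiv> gen_prod m f"

lemma lty_irrefl: "w \<in> Y \<Longrightarrow> \<not> lty w w"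
  using lty by (simp add: monomial_order_def)

lemma lty_trans: "lty u v \<Longrightarrow> lty v w \<Longrightarrow> u \<in> Y \<Longrightarrow> v \<in> Y \<Longrightarrow> w \<in> Y \<Longrightarrow> lty u w"
  using lty unfolding monomial_order_def by blast

lemma lty_total: "v \<in> Y \<Longrightarrow> w \<in> Y \<Longrightarrow> v = w \<or> lty v w \<or> lty w v"
  using lty unfolding monomial_order_def by blast

lemma lty_add: "lty u v \<Longrightarrow> u \<in> Y \<Longrightarrow> v \<in> Y \<Longrightarrow> w \<in> Y \<Longrightarrow> lty (u + w) (v + w)"
  using lty unfolding monomial_order_def by blast

lemma strict_total_lty: "A \<subseteq> Y \<Longrightarrow> strict_total_on A lty"
  unfolding strict_total_on_def irreflp_on_def transp_on_def totalp_on_def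
  using lty_irrefl lty_trans lty_total by blast

text \<open>
  This is the condition for \<open>x\<^sup>c y\<^sup>w\<close> to be an initial monomial of the Rees ideal, see
  \<open>initial_mons_rees_ideal\<close>. Distinct monomials with the same image under \<open>rees_map f\<close> differ in
  their \<open>y\<close>-parts, so \<open>lty\<close> decides which of them is larger.
\<close>

definition initial :: "'x mon \<Rightarrow> nat mon \<Rightarrow> bool" where
  "initial c w \<longleftrightarrow> (\<exists>w'\<in>Y. deg w' = deg w \<and> lty w' w \<and> F w' \<preceq> c + F w)"

text \<open>The initial monomials form the monomials of an ideal.\<close>

lemma initial_mult:
  assumes "initial a b" "a \<preceq> c" "b \<preceq> w" "w \<in> Y"
  shows "initial c w"
proof -
  from assms(1) obtain b' where b': "b' \<in> Y" "deg b' = deg b" "lty b' b" "F b' \<preceq> a + F b"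
    unfolding initial_def by blast
  obtain s t where st: "c = a + s" "w = b + t" using assms(2,3) by (auto elim!: mon_dvdE)
  have "F (b' + t) \<preceq> a + F b + F t" using b'(4) by (simp add: gen_prod_add)
  also have "\<dots> \<preceq> c + F w" by (simp add: st gen_prod_add mon_dvd_def lookup_add)
  finally show ?thesis
    unfolding initial_def using b' assms(4) lty_add[OF b'(3)] by (intro bexI[of _ "b' + t"]) (auto simp: st)
qed

lemma not_initial_0: "\<not> initial c 0"
  unfolding initial_def using lty_irrefl[of 0] by auto

definition standard :: "nat \<Rightarrow> nat mon set" where
  "standard k = {w \<in> Y. deg w = k \<and> \<not> initial 0 w}"

lemma standardD: "w \<in> standard k \<Longrightarrow> w \<in> Y" "w \<in> standard k \<Longrightarrow> deg w = k"
  by (simp_all add: standard_def)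

lemma finite_standard: "finite (standard k)"
  by (rule finite_subset[OF _ finite_mons_of_deg[of "{..<m}" k]]) (auto simp: standard_def)

lemma least_deg_mon:
  assumes "v \<in> Y" "deg v = k" "P v"
  obtains w where "w \<in> Y" "deg w = k" "P w"
    "\<forall>u\<in>Y. deg u = k \<longrightarrow> P u \<longrightarrow> w = u \<or> lty w u"
proof -
  let ?A = "{w \<in> Y. deg w = k \<and> P w}"
  have "finite ?A" by (rule finite_subset[OF _ finite_mons_of_deg[of "{..<m}" k]]) auto
  moreover have "?A \<noteq> {}" using assms by blast
  moreover have "strict_total_on ?A lty" by (rule strict_total_lty) auto
  ultimately obtain w where "w \<in> ?A" "\<forall>u\<in>?A. w = u \<or> lty w u" by (rule strict_total_on_least)
  then show ?thesis using that by blast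
qed

text \<open>
  Take the least \<open>w\<close> of the same degree for which \<open>F w\<close> divides \<open>F v\<close>; were it initial, there would be a
  smaller one.
\<close>

lemma standard_below:
  assumes "v \<in> Y" "deg v = k"
  obtains w where "w \<in> standard k" "F w \<preceq> F v" "w = v \<or> lty w v"
proof -
  from least_deg_mon[of v k "\<lambda>w. F w \<preceq> F v", OF assms mon_dvd_refl]
  obtain w where w: "w \<in> Y" "deg w = k" "F w \<preceq> F v"
    and least: "\<forall>u\<in>Y. deg u = k \<longrightarrow> F u \<preceq> F v \<longrightarrow> w = u \<or> lty w u" .
  have "\<not> initial 0 w"
  proof
    assume "initial 0 w"
    then obtain u where u: "u \<in> Y" "deg u = k" "lty u w" "F u \<preceq> F w"
      using w by (auto simp: initial_def)
    then have "w = u \<or> lty w u" using w least mon_dvd_trans by blast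
    then show False using u w lty_irrefl lty_trans by blast
  qed
  then show ?thesis using w least assms that by (auto simp: standard_def)
qed

text \<open>
  In each fibre of \<open>F\<close> only the least exponent vector can be standard.
\<close>

lemma inj_on_F_standard: "inj_on F (standard k)"
proof (rule inj_onI, rule ccontr)
  fix v w assume vw: "v \<in> standard k" "w \<in> standard k" "F v = F w" "v \<noteq> w"
  then have "initial 0 v \<or> initial 0 w"
    using lty_total[of v w] by (auto simp: standard_def initial_def)
  then show False using vw by (simp add: standard_def)
qed

lemma monomial_ideal_standard:
  "monomial_ideal (F ` standard k) =
    (monomial_ideal (F ` {w \<in> Y. deg w = k}) :: ('x, 'k::field) mpoly set)"
proof (intro subset_antisym monomial_ideal_mono_dvd)
  show "\<exists>h\<in>F ` {w \<in> Y. deg w = k}. h \<preceq> g" if "g \<in> F ` standard k" for g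
    using that mon_dvd_refl by (auto simp: standard_def)
  show "\<exists>h\<in>F ` standard k. h \<preceq> g" if "g \<in> F ` {w \<in> Y. deg w = k}" for g
    using that by (auto elim: standard_below)
qed

end

section \<open>Quadratic initial ideals\<close>

locale quadratic_generators = ordered_generators +
  assumes antichain: "i < m \<Longrightarrow> j < m \<Longrightarrow> f i \<preceq> f j \<Longrightarrow> i = j"
    and quadratic: "w \<in> Y \<Longrightarrow> initial c w \<Longrightarrow>
      \<exists>a b. a \<preceq> c \<and> b \<preceq> w \<and> deg a + deg b = 2 \<and> initial a b"
begin

text \<open>
  A quadratic monomial in the \<open>x\<^sub>i\<close> alone is not initial, because \<open>J\<close> contains no nonzero polynomial
  free of the \<open>y\<^sub>j\<close>.
\<close>

lemma mixed_or_yy: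
  assumes "w \<in> Y" "initial c w"
  obtains (mixed) x i where "Poly_Mapping.single x 1 \<preceq> c" "Poly_Mapping.single i 1 \<preceq> w"
      "initial (Poly_Mapping.single x 1) (Poly_Mapping.single i 1)"
  | (yy) b where "b \<preceq> w" "deg b = 2" "initial 0 b"
proof -
  from quadratic[OF assms] obtain a b where ab: "a \<preceq> c" "b \<preceq> w" "deg a + deg b = 2" "initial a b"
    by blast
  have "deg b \<noteq> 0" using ab(4) not_initial_0 by auto
  then consider "deg a = 1" "deg b = 1" | "deg a = 0" "deg b = 2" using ab(3) by linarith
  then show ?thesis
  proof cases
    case 1
    then obtain x i where "a = Poly_Mapping.single x 1" "b = Poly_Mapping.single i 1"
      by (metis deg_1E)
    then show ?thesis using ab mixed by blast
  next
    case 2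
    then show ?thesis using ab yy by auto
  qed
qed

text \<open>
  A descent on counterexamples \<open>v\<close>: the initial monomial \<open>x\<^sup>c y\<^sup>v\<close>, where \<open>F w = x\<^sup>c F v\<close>, is reduced by a
  quadratic binomial. That binomial replaces \<open>x\<^sup>a y\<^sup>b\<close> by \<open>x\<^bsup>a'\<^esup> y\<^bsup>b'\<^esup>\<close>, and the smaller exponent vector
  \<open>v - b + b'\<close> is again a counterexample unless \<open>c - a + a'\<close> vanishes.
\<close>

lemma standard_minimal:
  assumes "w \<in> standard k" "v \<in> Y" "deg v = k" "F v \<preceq> F w"
  shows "F v = F w"
proof (rule ccontr)
  assume "F v \<noteq> F w"
  with assms(4) have "F v \<preceq> F w \<and> F v \<noteq> F w" by simp
  from least_deg_mon[of v k "\<lambda>v. F v \<preceq> F w \<and> F v \<noteq> F w", OF assms(2,3) this]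
  obtain v where v: "v \<in> Y" "deg v = k" "F v \<preceq> F w \<and> F v \<noteq> F w"
    and least: "\<forall>u\<in>Y. deg u = k \<longrightarrow> F u \<preceq> F w \<and> F u \<noteq> F w \<longrightarrow> v = u \<or> lty v u" .
  have w: "w \<in> Y" "deg w = k" "\<not> initial 0 w" using assms(1) by (simp_all add: standard_def)
  have "\<not> lty v w" using w v by (auto simp: initial_def)
  then have "lty w v" using lty_total[of v w] v w by auto
  from v(3) have "F v \<preceq> F w" ..
  then obtain c where c: "F w = F v + c" by (rule mon_dvdE)
  then have "c \<noteq> 0" using v(3) by auto
  have "initial c v" using \<open>lty w v\<close> w v by (auto simp: initial_def c add.commute)
  \<comment> \<open>One reduction step by the binomial \<open>x\<^sup>a y\<^sup>b - x\<^bsup>a'\<^esup> y\<^bsup>b'\<^esup>\<close>.\<close>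
  have reduce: False
    if b: "b \<preceq> v" and b': "b' \<in> Y" "deg b' = deg b" "lty b' b" and a: "a \<preceq> c"
      and eq: "a' + F b' = a + F b" and nz: "c - a + a' \<noteq> 0" for a a' b b'
  proof -
    from b obtain s where s: "v = b + s" by (rule mon_dvdE)
    from a obtain r where r: "c = a + r" by (rule mon_dvdE)
    let ?u = "b' + s"
    have u: "?u \<in> Y" "deg ?u = k" "lty ?u v"
      using v b' s lty_add[of b' b s] by auto
    have "F w = F s + r + (a + F b)" by (simp add: c s r gen_prod_add ac_simps)
    then have "F w = F ?u + (r + a')" by (simp add: gen_prod_add ac_simps flip: eq)
    moreover have "r + a' \<noteq> 0" using nz by (simp add: r)
    ultimately have "F ?u \<preceq> F w" "F ?u \<noteq> F w" by auto
    then have "v = ?u \<or> lty v ?u" using u least by blast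
    then show False using u v lty_irrefl lty_trans by metis
  qed
  from v(1) \<open>initial c v\<close> show False
  proof (cases rule: mixed_or_yy)
    case (mixed x i)
    let ?x = "Poly_Mapping.single x (1::nat)" and ?i = "Poly_Mapping.single i (1::nat)"
    have i: "i < m" using mons_in_mon_dvd[OF mixed(2) v(1)] by (simp del: One_nat_def)
    from mixed(3) obtain b' where b': "b' \<in> Y" "deg b' = 1" "lty b' ?i" "F b' \<preceq> ?x + F ?i"
      unfolding initial_def deg_single by blast
    from deg_1E[OF b'(2)] obtain j where j: "b' = Poly_Mapping.single j 1" .
    then have "j < m" using b'(1) by (simp del: One_nat_def)
    from b'(4) obtain a' where a': "?x + F ?i = F b' + a'" by (rule mon_dvdE)
    have "a' \<noteq> 0"
    proof
      assume "a' = 0"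
      then have "f j = ?x + f i"
        using a' i \<open>j < m\<close> by (simp add: j gen_prod_single del: One_nat_def)
      then have "i = j" using antichain[OF i \<open>j < m\<close>] by simp
      then show False using b' j lty_irrefl by blast
    qed
    have "c - ?x + a' \<noteq> 0"
    proof
      assume "c - ?x + a' = 0"
      then have "deg (c - ?x + a') = 0" by simp
      then show False using \<open>a' \<noteq> 0\<close> by simp
    qed
    then show False
      using reduce[OF mixed(2) b'(1) _ b'(3) mixed(1), of a'] a' b'(2) by (simp add: add.commute)
  next
    case (yy b)
    then obtain b' where b': "b' \<in> Y" "deg b' = deg b" "lty b' b" "F b' \<preceq> F b"
      by (auto simp: initial_def)
    from b'(4) obtain a' where a': "F b = F b' + a'" by (rule mon_dvdE)
    have "c + a' \<noteq> 0"
    proof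
      assume "c + a' = 0"
      then have "deg (c + a') = 0" by simp
      then show False using \<open>c \<noteq> 0\<close> by simp
    qed
    then show False
      using reduce[OF yy(1) b'(1,2,3) zero_mon_dvd, of a'] a' by (simp add: add.commute)
  qed
qed

lemma mon_antichain_standard: "mon_antichain (F ` standard k)"
  unfolding mon_antichain_def using standard_minimal standardD by fast

text \<open>
  If \<open>F v\<close> divides \<open>x\<^sup>c F w\<close> with \<open>v\<close> before \<open>w\<close>, then \<open>x\<^sup>c y\<^sup>w\<close> is initial. As \<open>y\<^sup>w\<close> itself is not, its
  quadratic initial divisor involves a variable \<open>x\<close> of \<open>x\<^sup>c\<close>, and this is the required linear form.
\<close>

lemma standard_lin_quot:
  assumes "v \<in> standard k" "w \<in> standard k" "lty v w"
  shows "\<exists>x. Poly_Mapping.lookup (F w) x < Poly_Mapping.lookup (F v) x \<and>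
    (\<exists>u\<in>standard k. lty u w \<and> F u \<preceq> F w + Poly_Mapping.single x 1)"
proof -
  note Y = assms(1,2)[THEN standardD(1)] and deg = assms(1,2)[THEN standardD(2)]
  let ?c = "F v - F w"
  have "F v \<preceq> ?c + F w"
    unfolding mon_dvd_def lookup_add lookup_minus by (intro allI) linarith
  then have "initial ?c w" using assms(3) Y deg by (auto simp: initial_def)
  with Y(2) show ?thesis
  proof (cases rule: mixed_or_yy)
    case (mixed x i)
    let ?x = "Poly_Mapping.single x (1::nat)"
    have "initial ?x w" using initial_mult[OF mixed(3) mon_dvd_refl mixed(2) Y(2)] .
    then obtain w' where w': "w' \<in> Y" "deg w' = k" "lty w' w" "F w' \<preceq> ?x + F w"
      using deg by (auto simp: initial_def)
    obtain u where u: "u \<in> standard k" "F u \<preceq> F w'" "u = w' \<or> lty u w'"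
      using standard_below[OF w'(1,2)] .
    have "lty u w" using u w' Y lty_trans[of u w' w] standardD by auto
    moreover have "F u \<preceq> F w + ?x" using mon_dvd_trans[OF u(2) w'(4)] by (simp add: add.commute)
    moreover have "Poly_Mapping.lookup (F w) x < Poly_Mapping.lookup (F v) x"
      using mixed(1) unfolding single_mon_dvd_iff by (simp add: lookup_minus)
    ultimately show ?thesis using u(1) by blast
  next
    case (yy b)
    then have "initial 0 w" using initial_mult Y by simp
    then show ?thesis using assms by (simp add: standard_def)
  qed
qed

theorem lin_quot_order_standard: "\<exists>R. lin_quot_order (F ` standard k) R"
proof -
  define R where "R u v \<longleftrightarrow> (\<exists>a\<in>standard k. \<exists>b\<in>standard k. u = F a \<and> v = F b \<and> lty a b)" for u v
  have R: "R (F a) (F b) \<longleftrightarrow> lty a b" if "a \<in> standard k" "b \<in> standard k" for a b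
    using that inj_on_F_standard[of k] by (auto simp: R_def dest: inj_onD)
  have "strict_total_on (F ` standard k) R"
    unfolding strict_total_on_def irreflp_on_def transp_on_def totalp_on_def ball_simps
  proof (intro conjI ballI impI)
    fix a assume a: "a \<in> standard k"
    then show "\<not> R (F a) (F a)" using R lty_irrefl standardD by auto
    fix b assume b: "b \<in> standard k"
    show "R (F a) (F b) \<or> R (F b) (F a)" if "F a \<noteq> F b"
      using a b that R lty_total[of a b] standardD by auto
    fix c assume c: "c \<in> standard k"
    show "R (F a) (F c)" if "R (F a) (F b)" "R (F b) (F c)"
      using that a b c R lty_trans[of a b c] standardD by auto
  qed
  then have "lin_quot_order (F ` standard k) R"
    unfolding lin_quot_order_def using standard_lin_quot[of _ k] by (auto simp: R)
  then show ?thesis by blast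
qed

end

section \<open>Initial monomials of the Rees ideal\<close>

lemma lookup_x_part [simp]: "Poly_Mapping.lookup (x_part u) i = Poly_Mapping.lookup u (Inl i)"
  by (simp add: x_part_def map_key.rep_eq)

lemma lookup_y_part [simp]: "Poly_Mapping.lookup (y_part u) j = Poly_Mapping.lookup u (Inr j)"
  by (simp add: y_part_def map_key.rep_eq)

lemma xy_part_eqI: "x_part u = x_part v \<Longrightarrow> y_part u = y_part v \<Longrightarrow> u = v"
  by (rule poly_mapping_eqI) (metis lookup_x_part lookup_y_part sum.exhaust)

lemma x_part_mono: "u \<preceq> v \<Longrightarrow> x_part u \<preceq> x_part v"
  by (simp add: mon_dvd_def)

lemma y_part_mono: "u \<preceq> v \<Longrightarrow> y_part u \<preceq> y_part v"
  by (simp add: mon_dvd_def)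

lemma y_part_in_mons_in:
  fixes u :: "('x + nat) mon"
  assumes "u \<in> mons_in (T_vars m)"
  shows "y_part u \<in> mons_in {..<m}"
  unfolding mons_in_def
proof (intro CollectI subsetI)
  fix j assume "j \<in> Poly_Mapping.keys (y_part u)"
  then have "Inr j \<in> Poly_Mapping.keys u" by (simp add: in_keys_iff)
  then have "(Inr j :: 'x + nat) \<in> T_vars m" using assms by (auto simp: mons_in_def)
  then show "j \<in> {..<m}" by (auto simp: T_vars_def)
qed

definition xy_mon :: "'x mon \<Rightarrow> nat mon \<Rightarrow> ('x + nat) mon" where
  "xy_mon c w = (\<Sum>i\<in>Poly_Mapping.keys c. Poly_Mapping.single (Inl i) (Poly_Mapping.lookup c i)) +
     (\<Sum>j\<in>Poly_Mapping.keys w. Poly_Mapping.single (Inr j) (Poly_Mapping.lookup w j))"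

lemma x_part_xy_mon [simp]: "x_part (xy_mon c w) = c"
  by (rule poly_mapping_eqI)
    (auto simp: xy_mon_def lookup_add lookup_sum lookup_single when_def in_keys_iff)

lemma y_part_xy_mon [simp]: "y_part (xy_mon c w) = w"
  by (rule poly_mapping_eqI)
    (auto simp: xy_mon_def lookup_add lookup_sum lookup_single when_def in_keys_iff)

lemma xy_mon_in_mons_in: 
  assumes "w \<in> mons_in {..<m}"
  shows "xy_mon c w \<in> mons_in (T_vars m)"
  unfolding mons_in_def
proof (intro CollectI subsetI)
  fix v assume v: "v \<in> Poly_Mapping.keys (xy_mon c w)"
  show "v \<in> T_vars m"
  proof (cases v)
    case (Inl i)
    then show ?thesis by (simp add: T_vars_def)
  next
    case (Inr j)
    then have "j \<in> Poly_Mapping.keys w"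
      using v lookup_y_part[of "xy_mon c w" j] by (simp add: in_keys_iff)
    then show ?thesis using assms Inr by (auto simp: T_vars_def mons_in_def)
  qed
qed

lemma deg_xy_parts:
  fixes u :: "('x::finite + nat) mon"
  assumes "u \<in> mons_in (T_vars m)"
  shows "deg u = deg (x_part u) + deg (y_part u)"
proof -
  have "deg u = (\<Sum>v\<in>range Inl \<union> Inr ` {..<m}. Poly_Mapping.lookup u v)"
    using assms by (intro deg_superset) (auto simp: mons_in_def T_vars_def)
  also have "\<dots> = (\<Sum>v\<in>range Inl. Poly_Mapping.lookup u v) + (\<Sum>v\<in>Inr ` {..<m}. Poly_Mapping.lookup u v)"
    by (rule sum.union_disjoint) auto
  also have "\<dots> = (\<Sum>i\<in>UNIV. Poly_Mapping.lookup (x_part u) i) + (\<Sum>j<m. Poly_Mapping.lookup (y_part u) j)"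
    by (simp add: sum.reindex)
  also have "\<dots> = deg (x_part u) + deg (y_part u)"
    using y_part_in_mons_in[OF assms]
    by (simp add: deg_superset[of UNIV "x_part u"] deg_superset[of "{..<m}" "y_part u"] mons_in_def)
  finally show ?thesis .
qed

lemma pmon_sum: "pmon (\<Sum>i\<in>A. u i) = (\<Prod>i\<in>A. pmon (u i))"
  by (induction A rule: infinite_finite_induct) (simp_all add: pmon_add)

lemma prod_monom: "(\<Prod>i\<in>A. monom (a i) (n i)) = monom (\<Prod>i\<in>A. a i) (\<Sum>i\<in>A. n i)"
  by (induction A rule: infinite_finite_induct) (simp_all add: mult_monom)

text \<open>
  The image of the monomial \<open>u\<close> under \<open>rees_map f\<close> is \<open>rees_mon m f u\<close> times a power of \<open>t\<close>.
\<close>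

definition rees_mon :: "nat \<Rightarrow> (nat \<Rightarrow> 'x mon) \<Rightarrow> ('x + nat) mon \<Rightarrow> 'x mon" where
  "rees_mon m f u = x_part u + gen_prod m f (y_part u)"

lemma rees_map_eq:
  fixes p :: "('x::finite + nat, 'k::field) mpoly"
  assumes "p \<in> polys_in (T_vars m)"
  shows "rees_map f p = (\<Sum>u\<in>Poly_Mapping.keys p.
    monom (Poly_Mapping.single (rees_mon m f u) (Poly_Mapping.lookup p u)) (deg (y_part u)))"
  unfolding rees_map_def eval_hom_def
proof (rule sum.cong[OF refl])
  fix u assume "u \<in> Poly_Mapping.keys p"
  then have u: "u \<in> mons_in (T_vars m)" using assms by (auto simp: polys_in_def)
  let ?g = "case_sum (\<lambda>i. [:pmon (Poly_Mapping.single i 1):]) (\<lambda>j. monom (pmon (f j)) 1)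
    :: 'x + nat \<Rightarrow> ('x, 'k) mpoly poly"
  let ?h = "\<lambda>v. ?g v ^ Poly_Mapping.lookup u v"
  have "(\<Prod>v\<in>Poly_Mapping.keys u. ?h v) = (\<Prod>v\<in>range Inl \<union> Inr ` {..<m}. ?h v)"
    using u by (intro prod.mono_neutral_left) (auto simp: mons_in_def T_vars_def in_keys_iff)
  also have "\<dots> = (\<Prod>v\<in>range Inl. ?h v) * (\<Prod>v\<in>Inr ` {..<m}. ?h v)"
    by (rule prod.union_disjoint) auto
  also have "(\<Prod>v\<in>range Inl. ?h v) =
      (\<Prod>i\<in>UNIV. monom (pmon (\<Sum>_<Poly_Mapping.lookup u (Inl i). Poly_Mapping.single i 1)) 0)"
    by (simp add: prod.reindex pmon_sum monom_0 monom_power flip: monom_0)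
  also have "\<dots> = monom (pmon (x_part u)) 0"
  proof -
    have "(\<Sum>i\<in>UNIV. \<Sum>_<Poly_Mapping.lookup u (Inl i). Poly_Mapping.single i 1) = x_part u"
      by (rule poly_mapping_eqI) (simp add: lookup_sum lookup_single when_def if_distrib cong: if_cong)
    then show ?thesis by (simp add: prod_monom flip: pmon_sum)
  qed
  also have "(\<Prod>v\<in>Inr ` {..<m}. ?h v) =
      (\<Prod>j<m. monom (pmon (\<Sum>_<Poly_Mapping.lookup u (Inr j). f j)) (Poly_Mapping.lookup u (Inr j)))"
    by (simp add: prod.reindex pmon_sum monom_power)
  also have "\<dots> = monom (pmon (gen_prod m f (y_part u))) (deg (y_part u))"
    using y_part_in_mons_in[OF u] deg_superset[of "{..<m}" "y_part u"]
    by (simp add: prod_monom gen_prod_def mons_in_def flip: pmon_sum)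
  finally have "(\<Prod>v\<in>Poly_Mapping.keys u. ?h v) = monom (pmon (rees_mon m f u)) (deg (y_part u))"
    by (simp add: mult_monom rees_mon_def pmon_add)
  then show "[:Poly_Mapping.single 0 (Poly_Mapping.lookup p u):] * (\<Prod>v\<in>Poly_Mapping.keys u. ?h v) =
      monom (Poly_Mapping.single (rees_mon m f u) (Poly_Mapping.lookup p u)) (deg (y_part u))"
    by (simp add: smult_monom pmon_def mult_single)
qed

text \<open>
  In the coefficient of \<open>rees_map f p\<close> at the image of \<open>u\<close>, the contribution of \<open>u\<close> has to cancel.
\<close>

lemma rees_ideal_partner:
  fixes p :: "('x::finite + nat, 'k::field) mpoly"
  assumes "p \<in> rees_ideal m f" "u \<in> Poly_Mapping.keys p"
  obtains v where "v \<in> Poly_Mapping.keys p" "v \<noteq> u" "rees_mon m f v = rees_mon m f u"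
    "deg (y_part v) = deg (y_part u)"
proof -
  let ?same = "\<lambda>v. rees_mon m f v = rees_mon m f u \<and> deg (y_part v) = deg (y_part u)"
  have "0 = Poly_Mapping.lookup (poly.coeff (rees_map f p) (deg (y_part u))) (rees_mon m f u)"
    using assms by (simp add: rees_ideal_def)
  also have "\<dots> = (\<Sum>v\<in>Poly_Mapping.keys p. if ?same v then Poly_Mapping.lookup p v else 0)"
    using assms(1) by (subst rees_map_eq[of p m])
      (auto simp: rees_ideal_def coeff_sum lookup_sum lookup_single when_def intro!: sum.cong)
  also have "\<dots> = Poly_Mapping.lookup p u +
      (\<Sum>v\<in>Poly_Mapping.keys p - {u}. if ?same v then Poly_Mapping.lookup p v else 0)"
    using assms(2) by (subst sum.remove) auto
  finally have "(\<Sum>v\<in>Poly_Mapping.keys p - {u}. if ?same v then Poly_Mapping.lookup p v else 0) \<noteq> 0"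
    using assms(2) by (auto simp: in_keys_iff)
  then obtain v where "v \<in> Poly_Mapping.keys p - {u}"
    "(if ?same v then Poly_Mapping.lookup p v else 0) \<noteq> 0"
    by (rule sum.not_neutral_contains_not_neutral)
  then show ?thesis using that by (auto split: if_splits)
qed

context ordered_generators
begin

text \<open>
  An initial monomial \<open>u\<close> of \<open>p\<close> cancels against another monomial of \<open>p\<close>, which is smaller and has the
  same image. Conversely a smaller monomial with the same image yields a binomial in the ideal.
\<close>

lemma initial_mons_rees_ideal:
  fixes u :: "('x + nat) mon"
  shows "u \<in> initial_mons (T_order ltx lty) (rees_ideal m f :: ('x + nat, 'k::field) mpoly set) \<longleftrightarrow>
    u \<in> mons_in (T_vars m) \<and> initial (x_part u) (y_part u)"
proof (intro iffI conjI)
  assume "u \<in> initial_mons (T_order ltx lty) (rees_ideal m f :: ('x + nat, 'k) mpoly set)"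
  then obtain p :: "('x + nat, 'k) mpoly" where p: "p \<in> rees_ideal m f" "u \<in> Poly_Mapping.keys p"
    and max: "\<And>v. v \<in> Poly_Mapping.keys p \<Longrightarrow> v \<noteq> u \<Longrightarrow> T_order ltx lty v u"
    by (auto simp: initial_mons_def)
  have keys: "v \<in> mons_in (T_vars m)" if "v \<in> Poly_Mapping.keys p" for v
    using p(1) that by (auto simp: rees_ideal_def polys_in_def)
  then show "u \<in> mons_in (T_vars m)" using p(2) by blast
  obtain v where v: "v \<in> Poly_Mapping.keys p" "v \<noteq> u" "rees_mon m f v = rees_mon m f u"
    "deg (y_part v) = deg (y_part u)" using rees_ideal_partner[OF p] .
  have "y_part v \<noteq> y_part u"
    using v(2,3) xy_part_eqI[of v u] by (auto simp: rees_mon_def)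
  then have "lty (y_part v) (y_part u)" using max[OF v(1,2)] by (auto simp: T_order_def)
  moreover have "F (y_part v) \<preceq> x_part u + F (y_part u)"
    using v(3) mon_dvd_add(2) by (metis rees_mon_def)
  moreover have "y_part v \<in> Y" using keys[OF v(1)] by (rule y_part_in_mons_in)
  ultimately show "initial (x_part u) (y_part u)" using v(4) by (auto simp: initial_def)
next
  assume u: "u \<in> mons_in (T_vars m) \<and> initial (x_part u) (y_part u)"
  then obtain w where w: "w \<in> Y" "deg w = deg (y_part u)" "lty w (y_part u)"
    "F w \<preceq> x_part u + F (y_part u)" by (auto simp: initial_def)
  from w(4) obtain c where c: "x_part u + F (y_part u) = F w + c" by (rule mon_dvdE)
  let ?v = "xy_mon c w"
  let ?p = "pmon u - pmon ?v :: ('x + nat, 'k) mpoly"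
  have "w \<noteq> y_part u" using w lty_irrefl by blast
  then have ne: "?v \<noteq> u" by (metis y_part_xy_mon)
  have lookup: "Poly_Mapping.lookup ?p v = (if v = u then 1 else if v = ?v then - 1 else 0)" for v
    using ne by (auto simp: lookup_minus pmon_def lookup_single when_def)
  then have keys: "Poly_Mapping.keys ?p = {u, ?v}" by (auto simp: in_keys_iff split: if_splits)
  then have pin: "?p \<in> polys_in (T_vars m)" using u xy_mon_in_mons_in[OF w(1)] by (simp add: polys_in_def)
  have "rees_mon m f ?v = rees_mon m f u" using c by (simp add: rees_mon_def add.commute)
  then have "rees_map f ?p = 0"
    unfolding rees_map_eq[OF pin] keys lookup using ne w(2)
    by (simp add: add_monom flip: single_add)
  then have "?p \<in> rees_ideal m f" using pin by (simp add: rees_ideal_def)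
  moreover have "T_order ltx lty ?v u" using w(3) by (simp add: T_order_def)
  ultimately show "u \<in> initial_mons (T_order ltx lty) (rees_ideal m f :: ('x + nat, 'k) mpoly set)"
    unfolding initial_mons_def using keys by (intro CollectI bexI[of _ ?p]) auto
qed

end

lemma ideal_span_in_subset: "ideal_span_in R B \<subseteq> ideal_span B"
  unfolding ideal_span_in_def module.span_explicit[OF module_mult] by blast

lemma ideal_span_in_base: 
  assumes "b \<in> B" "1 \<in> R"
  shows "b \<in> ideal_span_in R B"
  unfolding ideal_span_in_def using assms
  by (intro CollectI exI[of _ "{b}"] exI[of _ "\<lambda>_. 1"]) auto

lemma one_in_polys_in: "1 \<in> polys_in V"
  by (simp add: polys_in_def)

text \<open>
  An initial monomial has a divisor \<open>q\<close> among the quadratic generators. The generator \<open>q\<close> is itself a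
  multiple of an initial monomial, hence initial.
\<close>

lemma (in ordered_generators) quadratic_initial_ideal:
  fixes ltx :: "'x mon \<Rightarrow> 'x mon \<Rightarrow> bool"
  assumes "generated_by_quadratic_monomials (T_vars m)
      (initial_ideal (T_vars m) (T_order ltx lty) (rees_ideal m f :: ('x + nat, 'k::field) mpoly set))"
    and "w \<in> Y" "initial c w"
  shows "\<exists>a b. a \<preceq> c \<and> b \<preceq> w \<and> deg a + deg b = 2 \<and> initial a b"
proof -
  let ?in = "initial_mons (T_order ltx lty) (rees_ideal m f :: ('x + nat, 'k) mpoly set)"
  let ?span = "\<lambda>Q. ideal_span_in (polys_in (T_vars m)) (pmon ` Q) :: ('x + nat, 'k) mpoly set"
  from assms(1) obtain Q where Q: "Q \<subseteq> mons_in (T_vars m)" "\<And>u. u \<in> Q \<Longrightarrow> deg u = 2"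
    and eq: "?span ?in = ?span Q"
    unfolding generated_by_quadratic_monomials_def initial_ideal_def by blast
  have dvd: "\<exists>v\<in>A. v \<preceq> u" if "u \<in> B" "?span B = ?span A" for A B u
  proof -
    have "(pmon u :: ('x + nat, 'k) mpoly) \<in> ?span A"
      using that ideal_span_in_base[OF _ one_in_polys_in] by blast
    then have "(pmon u :: ('x + nat, 'k) mpoly) \<in> monomial_ideal A"
      using ideal_span_in_subset by (force simp flip: ideal_span_pmon)
    then show ?thesis by simp
  qed
  let ?u = "xy_mon c w"
  have "?u \<in> ?in" using assms(2,3) by (simp add: initial_mons_rees_ideal xy_mon_in_mons_in)
  then obtain q where q: "q \<in> Q" "q \<preceq> ?u" using dvd eq by blast
  then obtain u where u: "u \<in> ?in" "u \<preceq> q" using dvd eq[symmetric] by blast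
  have qT: "q \<in> mons_in (T_vars m)" using q Q by auto
  have "initial (x_part u) (y_part u)" using u(1) by (simp add: initial_mons_rees_ideal)
  then have "initial (x_part q) (y_part q)"
    using initial_mult x_part_mono[OF u(2)] y_part_mono[OF u(2)] y_part_in_mons_in[OF qT] by blast
  moreover have "deg (x_part q) + deg (y_part q) = 2" using deg_xy_parts[OF qT] Q(2) q(1) by simp
  moreover have "x_part q \<preceq> c" "y_part q \<preceq> w"
    using x_part_mono[OF q(2)] y_part_mono[OF q(2)] by simp_all
  ultimately show ?thesis by blast
qed

section \<open>Powers of ideals whose Rees ideal has a quadratic initial ideal\<close>

theorem theorem2p6:
  fixes I :: "('x::finite, 'k::field) mpoly set"
    and f :: "nat \<Rightarrow> 'x mon"
    and m :: nat
    and ltx :: "'x mon \<Rightarrow> 'x mon \<Rightarrow> bool"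
    and lty :: "nat mon \<Rightarrow> nat mon \<Rightarrow> bool"
  assumes "inj_on f {..<m}"
    and "minimal_monomial_generators (f ` {..<m}) I"
    and "monomial_order UNIV ltx"
    and "monomial_order {..<m} lty"
    and "\<And>i j. i < j \<Longrightarrow> j < m \<Longrightarrow> lty (Poly_Mapping.single i 1) (Poly_Mapping.single j 1)"
    and "generated_by_quadratic_monomials (T_vars m)
           (initial_ideal (T_vars m) (T_order ltx lty)
             (rees_ideal m f :: ('x + nat, 'k) mpoly set))"
  shows "\<forall>k\<ge>1. linear_quotients (ideal_power I k) \<and>
                componentwise_linear (*) (\<lambda>d. {p. homogeneous d p}) (ideal_power I k)"
proof -
  have I: "I = monomial_ideal (f ` {..<m})"
    and anti: "\<forall>g\<in>f ` {..<m}. \<forall>h\<in>f ` {..<m}. g \<preceq> h \<longrightarrow> g = h"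
    using assms(2) by (simp_all add: minimal_monomial_generators_iff)
  interpret ordered_generators m f lty by unfold_locales (rule assms(4))
  interpret quadratic_generators m f lty
  proof unfold_locales
    show "i = j" if "i < m" "j < m" "f i \<preceq> f j" for i j
      using anti that inj_onD[OF assms(1), of i j] by auto
    show "\<exists>a b. a \<preceq> c \<and> b \<preceq> w \<and> deg a + deg b = 2 \<and> initial a b" if "w \<in> Y" "initial c w" for w c
      using quadratic_initial_ideal[OF assms(6) that] .
  qed
  have "linear_quotients (ideal_power I k) \<and>
      componentwise_linear (*) (\<lambda>d. {p. homogeneous d p}) (ideal_power I k)" for k
  proof -
    have "ideal_power I k = monomial_ideal (F ` standard k)"
      by (simp add: I ideal_power_monomial monomial_ideal_standard)
    moreover obtain R where "lin_quot_order (F ` standard k) R" using lin_quot_order_standard by blast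
    ultimately show ?thesis
      using lin_quot_order_linear_quotients lin_quot_order_componentwise_linear
        finite_standard mon_antichain_standard by (metis finite_imageI)
  qed
  then show ?thesis by blast
qed

end
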